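(* Let $d\ge 2$ and let $G=T_d:=\mathbb{G}_m^d$ be the $d$-dimensional split torus. For each integer $k\ge 3$ define a faithful $\mathbb{Q}$-rational representation $\rho_{d,k}:G\to\mathrm{GL}_{2d-1}$ by $$\rho_{d,k}(x_1,\dots,x_d)=\mathrm{diag}(x_1,\dots,x_d,\,x_1^kx_d^{-1},\dots,x_{d-1}^kx_d^{-1}).$$ Then for all primes $p$, $$Z_{G,\rho_{d,k},p}(s)=\int_{G^+}|\det\rho_{d,k}(g)|^s\,\mu_G(g)$$ does not satisfy a functional equation.
   Context: For a prime $p$: $|\cdot|$ is the $p$-adic absolute value, $G^+=\{g\in G(\mathbb{Q}_p):\rho_{d,k}(g)\in\mathrm{M}_{2d-1}(\mathbb{Z}_p)\}$, and $\mu_G$ is the Haar measure on $G(\mathbb{Q}_p)$ normalized so that $\{g\in G(\mathbb{Q}_p):\rho_{d,k}(g)\in\mathrm{GL}_{2d-1}(\mathbb{Z}_p)\}$ has measure $1$; $s$ is a complex variable. The local zeta functions are called uniform if there is a rational function $Q(X,Y)$ with $Z_{G,\rho_{d,k},p}(s)=Q(p,p^{-s})$ for all primes $p$ (which is the case here); then $Z_{G,\rho_{d,k},p}(s)|_{p\to p^{-1}}:=Q(p^{-1},p^{s})$. One says $Z_{G,\rho_{d,k},p}(s)$ satisfies a functional equation if $$Z_{G,\rho_{d,k},p}(s)|_{p\to p^{-1}}=(-1)^mp^{a+bs}Z_{G,\rho_{d,k},p}(s)$$ for some integers $m,a,b$. *)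

theory Defs
  imports
    "HOL-Analysis.Analysis"
    "HOL-Combinatorics.Permutations"
    "HOL-Computational_Algebra.Computational_Algebra"
    "HOL-Computational_Algebra.Field_as_Ring"
    "HOL-Algebra.QuotRing"
    "HOL-Algebra.Product_Groups"
begin

section \<open>The field of p-adic numbers\<close>

definition rat_padic_val :: "nat \<Rightarrow> rat \<Rightarrow> int" where
  "rat_padic_val p x =
     int (multiplicity (int p) (fst (quotient_of x))) - int (multiplicity (int p) (snd (quotient_of x)))"

definition rat_padic_abs :: "nat \<Rightarrow> rat \<Rightarrow> real" where
  "rat_padic_abs p x = (if x = 0 then 0 else real p powi (- rat_padic_val p x))"

text \<open>
  The field of p-adic numbers is the completion of the rationals: the ring of p-adic Cauchy
  sequences modulo the ideal of null sequences. It is a value-level ring (rather than a type) so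
  that \<open>p\<close> can be quantified inside formulas.
\<close>

definition padic_cauchy_ring :: "nat \<Rightarrow> (nat \<Rightarrow> rat) ring" where
  "padic_cauchy_ring p =
     \<lparr>carrier = {x. \<forall>e>0. \<exists>N. \<forall>m\<ge>N. \<forall>n\<ge>N. rat_padic_abs p (x m - x n) < e},
      monoid.mult = (\<lambda>x y n. x n * y n),
      one = (\<lambda>n. 1),
      zero = (\<lambda>n. 0),
      add = (\<lambda>x y n. x n + y n)\<rparr>"

definition padic_null_ideal :: "nat \<Rightarrow> (nat \<Rightarrow> rat) set" where
  "padic_null_ideal p = {x. (\<lambda>n. rat_padic_abs p (x n)) \<longlonglongrightarrow> 0}"

type_synonym padic = "(nat \<Rightarrow> rat) set"

definition Qp :: "nat \<Rightarrow> padic ring" where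
  "Qp p = padic_cauchy_ring p Quot padic_null_ideal p"

definition padic_abs :: "nat \<Rightarrow> padic \<Rightarrow> real" where
  "padic_abs p X = (THE r. \<exists>x\<in>X. (\<lambda>n. rat_padic_abs p (x n)) \<longlonglongrightarrow> r)"

definition Zp :: "nat \<Rightarrow> padic ring" where
  "Zp p = (Qp p)\<lparr>carrier := {x \<in> carrier (Qp p). padic_abs p x \<le> 1}\<rparr>"

definition Qp_topology :: "nat \<Rightarrow> padic topology" where
  "Qp_topology p =
     Metric_space.mtopology (carrier (Qp p)) (\<lambda>x y. padic_abs p (x \<ominus>\<^bsub>Qp p\<^esub> y))"


section \<open>Matrices over a ring\<close>

text \<open>
  An \<open>n\<close> by \<open>n\<close> matrix is a function of which only the entries with both indices
  in \<open>{1..n}\<close> are relevant.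
\<close>

definition matrices :: "nat \<Rightarrow> ('a, 'b) ring_scheme \<Rightarrow> (nat \<Rightarrow> nat \<Rightarrow> 'a) set" where
  "matrices n R = {A. \<forall>i\<in>{1..n}. \<forall>j\<in>{1..n}. A i j \<in> carrier R}"

definition mutually_inverse ::
  "nat \<Rightarrow> ('a, 'b) ring_scheme \<Rightarrow> (nat \<Rightarrow> nat \<Rightarrow> 'a) \<Rightarrow> (nat \<Rightarrow> nat \<Rightarrow> 'a) \<Rightarrow> bool" where
  "mutually_inverse n R A B \<longleftrightarrow>
     (\<forall>i\<in>{1..n}. \<forall>j\<in>{1..n}.
        finsum R (\<lambda>l. A i l \<otimes>\<^bsub>R\<^esub> B l j) {1..n} = (if i = j then \<one>\<^bsub>R\<^esub> else \<zero>\<^bsub>R\<^esub>) \<and>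
        finsum R (\<lambda>l. B i l \<otimes>\<^bsub>R\<^esub> A l j) {1..n} = (if i = j then \<one>\<^bsub>R\<^esub> else \<zero>\<^bsub>R\<^esub>))"

definition GL :: "nat \<Rightarrow> ('a, 'b) ring_scheme \<Rightarrow> (nat \<Rightarrow> nat \<Rightarrow> 'a) set" where
  "GL n R = {A \<in> matrices n R. \<exists>B\<in>matrices n R. mutually_inverse n R A B}"

definition mat_det :: "nat \<Rightarrow> ('a, 'b) ring_scheme \<Rightarrow> (nat \<Rightarrow> nat \<Rightarrow> 'a) \<Rightarrow> 'a" where
  "mat_det n R A =
     finsum R (\<lambda>\<sigma>. add_pow R (sign \<sigma> :: int) (finprod R (\<lambda>i. A i (\<sigma> i)) {1..n}))
       {\<sigma>. \<sigma> permutes {1..n}}"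


section \<open>The split torus and its representation\<close>

text \<open>The group of \<open>R\<close>-points of the \<open>d\<close>-dimensional split torus.\<close>

definition torus :: "nat \<Rightarrow> ('a, 'b) ring_scheme \<Rightarrow> (nat \<Rightarrow> 'a) monoid" where
  "torus d R = product_group {1..d} (\<lambda>_. units_of R)"

definition rho ::
  "nat \<Rightarrow> nat \<Rightarrow> ('a, 'b) ring_scheme \<Rightarrow> (nat \<Rightarrow> 'a) \<Rightarrow> (nat \<Rightarrow> nat \<Rightarrow> 'a)" where
  "rho d k R x = (\<lambda>i j.
     if i \<noteq> j then \<zero>\<^bsub>R\<^esub>
     else if i \<le> d then x i
     else (x (i - d) [^]\<^bsub>R\<^esub> k) \<otimes>\<^bsub>R\<^esub> inv\<^bsub>R\<^esub> (x d))"

definition torus_topology :: "nat \<Rightarrow> nat \<Rightarrow> (nat \<Rightarrow> padic) topology" where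
  "torus_topology d p =
     product_topology (\<lambda>_. subtopology (Qp_topology p) (Units (Qp p))) {1..d}"


section \<open>Haar measure\<close>

text \<open>
  A left Haar measure: a nonzero left-invariant Radon measure on the Borel sets of the
  (locally compact Hausdorff) topological group \<open>G\<close> with topology \<open>T\<close>.
\<close>

definition haar_measure :: "('a, 'b) monoid_scheme \<Rightarrow> 'a topology \<Rightarrow> 'a measure \<Rightarrow> bool" where
  "haar_measure G T M \<longleftrightarrow>
     space M = carrier G \<and>
     sets M = sigma_sets (carrier G) {U. openin T U} \<and>
     emeasure M (carrier G) \<noteq> 0 \<and>
     (\<forall>g\<in>carrier G. \<forall>A\<in>sets M. emeasure M (g <#\<^bsub>G\<^esub> A) = emeasure M A) \<and>
     (\<forall>K. compactin T K \<longrightarrow> emeasure M K < \<infinity>) \<and>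
     (\<forall>A\<in>sets M. emeasure M A = (INF U\<in>{U. openin T U \<and> A \<subseteq> U}. emeasure M U)) \<and>
     (\<forall>U. openin T U \<longrightarrow> emeasure M U = (SUP K\<in>{K. compactin T K \<and> K \<subseteq> U}. emeasure M K))"

definition normalized_haar_measure :: "nat \<Rightarrow> nat \<Rightarrow> nat \<Rightarrow> (nat \<Rightarrow> padic) measure \<Rightarrow> bool" where
  "normalized_haar_measure d k p M \<longleftrightarrow>
     haar_measure (torus d (Qp p)) (torus_topology d p) M \<and>
     emeasure M {g \<in> carrier (torus d (Qp p)). rho d k (Qp p) g \<in> GL (2 * d - 1) (Zp p)} = 1"


section \<open>The local zeta functions\<close>

definition G_plus :: "nat \<Rightarrow> nat \<Rightarrow> nat \<Rightarrow> (nat \<Rightarrow> padic) set" where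
  "G_plus d k p =
     {g \<in> carrier (torus d (Qp p)). rho d k (Qp p) g \<in> matrices (2 * d - 1) (Zp p)}"

definition zeta_integrand :: "nat \<Rightarrow> nat \<Rightarrow> nat \<Rightarrow> complex \<Rightarrow> (nat \<Rightarrow> padic) \<Rightarrow> complex" where
  "zeta_integrand d k p s g =
     complex_of_real (padic_abs p (mat_det (2 * d - 1) (Qp p) (rho d k (Qp p) g))) powr s"

definition zeta_converges :: "nat \<Rightarrow> nat \<Rightarrow> nat \<Rightarrow> (nat \<Rightarrow> padic) measure \<Rightarrow> complex \<Rightarrow> bool" where
  "zeta_converges d k p M s \<longleftrightarrow> set_integrable M (G_plus d k p) (zeta_integrand d k p s)"

definition local_zeta :: "nat \<Rightarrow> nat \<Rightarrow> nat \<Rightarrow> (nat \<Rightarrow> padic) measure \<Rightarrow> complex \<Rightarrow> complex" where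
  "local_zeta d k p M s = set_lebesgue_integral M (G_plus d k p) (zeta_integrand d k p s)"


section \<open>Uniformity and functional equations\<close>

text \<open>
  Elements of \<open>complex poly poly\<close> are read as polynomials in \<open>Y\<close> with coefficients that are
  polynomials in \<open>X\<close>. A rational function is evaluated through its reduced fraction, so it is
  defined wherever the reduced denominator does not vanish.
\<close>

type_synonym ratfun2 = "complex poly poly fract"

definition eval2 :: "complex poly poly \<Rightarrow> complex \<Rightarrow> complex \<Rightarrow> complex" where
  "eval2 P x y = poly (poly P [:y:]) x"

definition ratfun_defined :: "ratfun2 \<Rightarrow> complex \<Rightarrow> complex \<Rightarrow> bool" where
  "ratfun_defined Q x y \<longleftrightarrow> eval2 (snd (quot_of_fract Q)) x y \<noteq> 0"

definition ratfun_eval :: "ratfun2 \<Rightarrow> complex \<Rightarrow> complex \<Rightarrow> complex" where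
  "ratfun_eval Q x y = eval2 (fst (quot_of_fract Q)) x y / eval2 (snd (quot_of_fract Q)) x y"

text \<open>
  The integral only converges on a right half-plane; identities between meromorphic functions of
  \<open>s\<close> are expressed on some right half-plane, which determines them by analytic continuation.
\<close>

definition uniform_with ::
  "nat \<Rightarrow> nat \<Rightarrow> (nat \<Rightarrow> (nat \<Rightarrow> padic) measure) \<Rightarrow> ratfun2 \<Rightarrow> bool" where
  "uniform_with d k \<mu> Q \<longleftrightarrow>
     (\<forall>p::nat. prime p \<longrightarrow>
       (\<exists>\<sigma>::real. \<forall>s. Re s > \<sigma> \<longrightarrow>
          zeta_converges d k p (\<mu> p) s \<and>
          ratfun_defined Q (of_nat p) (of_nat p powr (- s)) \<and>
          local_zeta d k p (\<mu> p) s = ratfun_eval Q (of_nat p) (of_nat p powr (- s))))"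

definition satisfies_functional_equation ::
  "nat \<Rightarrow> nat \<Rightarrow> (nat \<Rightarrow> (nat \<Rightarrow> padic) measure) \<Rightarrow> nat \<Rightarrow> bool" where
  "satisfies_functional_equation d k \<mu> p \<longleftrightarrow>
     (\<exists>Q. uniform_with d k \<mu> Q \<and>
       (\<exists>m a b :: int. \<exists>\<sigma>::real. \<forall>s. Re s > \<sigma> \<longrightarrow>
          ratfun_defined Q (1 / of_nat p) (of_nat p powr s) \<and>
          ratfun_eval Q (1 / of_nat p) (of_nat p powr s) =
            (- 1) powi m * of_nat p powr (of_int a + of_int b * s) * local_zeta d k p (\<mu> p) s))"

end

(*
  The absolute values of the coordinates cut G^+ into cells indexed by valuation vectors v with
  v_i >= 0 and k v_i >= v_d for i < d. All cells are translates of the unit cell, so each has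
  measure 1, and on a cell |det|^s = Y^((k + 1) (v_1 + ... + v_(d-1)) - (d - 2) v_d) with
  Y = p^(-s). Summing the geometric series gives Z = N(Y) / D(Y), where
    D = (1 - Y^(k + d - 1)) (1 - Y^(k + 1))^(d - 1),
    N = 1 + sum over 0 < m < k of Y^(k + d - 1 + (d - 2) (k - m)).
  A rational function Q that interpolates Z at all primes must equal N(Y) / D(Y), so X does not
  occur in it. As D is self-reciprocal up to sign, a functional equation would make N
  self-reciprocal up to a constant factor, which it is not for k >= 3.
*)

theory Submission
  imports Defs
begin

section \<open>The p-adic absolute value\<close>

text \<open>A functional equation at one fixed \<open>p\<close> tests an arbitrary interpolating
  \<open>Q\<close> at (1/p, p^s). The first coordinate is not a prime, and for Re s > 0 the second
  has modulus above 1, where the series diverges. Interpolation therefore has to be strengthened to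
  a polynomial identity in two variables; this is why all primes enter although the contradiction
  lives at a single one. Everything is sampled at natural numbers s = n: infinitely many powers of p
  decide a polynomial identity, so neither continuation nor branches of \<open>powr\<close> arise.

  Each nonzero exponent of N belongs to a residue class m of v_d modulo k, and (d - 2) (k - m) is
  the effect of rounding v_d / k up. For k = 2 the numerator is 1 + Y^(2 d - 1), which is
  self-reciprocal; from k = 3 on, the k - 1 upper exponents are d - 2 apart while the gap above 0 is
  k + 2 d - 3. For d = 2 the upper exponents coincide, so comparing coefficients would split into
  cases; values and first derivatives at 1 treat all d alike.\<close>

lemma rat_padic_val_divide:
  assumes "prime p" "a \<noteq> 0" "b \<noteq> 0"
  shows "rat_padic_val p (of_int a / of_int b) =
           int (multiplicity (int p) a) - int (multiplicity (int p) b)"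
proof -
  obtain c e where ce: "quotient_of (of_int a / of_int b) = (c, e)"
    by (cases "quotient_of (of_int a / of_int b)")
  then have e: "e > 0" and eq: "of_int a / of_int b = (of_int c / of_int e :: rat)"
    by (auto dest: quotient_of_denom_pos quotient_of_div)
  then have "of_int (a * e) = (of_int (c * b) :: rat)"
    using assms(3) by (simp add: field_simps)
  then have ae: "a * e = c * b"
    by (simp only: of_int_eq_iff)
  then have c: "c \<noteq> 0" using assms e by auto
  have P: "prime_elem (int p)" using assms(1) by simp
  have "multiplicity (int p) (a * e) = multiplicity (int p) (c * b)" by (simp only: ae)
  then have "multiplicity (int p) a + multiplicity (int p) e = multiplicity (int p) c + multiplicity (int p) b"
    using assms c e by (simp add: prime_elem_multiplicity_mult_distrib[OF P])
  then show ?thesis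
    unfolding rat_padic_val_def ce by simp
qed

text \<open>A shared denominator reduces sums and products to integer numerators;
  \<open>rat_padic_val_divide\<close> then evaluates fractions that need not be reduced.\<close>

lemma rat_common_denominator:
  fixes x y :: rat
  obtains a b n where "n \<noteq> 0" "x = of_int a / of_int n" "y = of_int b / of_int n"
proof -
  obtain a m b n where q: "quotient_of x = (a, m)" "quotient_of y = (b, n)"
    by (metis surj_pair)
  have "m > 0" "n > 0" "x = of_int a / of_int m" "y = of_int b / of_int n"
    using q quotient_of_denom_pos quotient_of_div by blast+
  then have "m * n \<noteq> 0" "x = of_int (a * n) / of_int (m * n)" "y = of_int (b * m) / of_int (m * n)"
    by auto
  then show thesis by (rule that)
qed

lemma rat_padic_abs_zero [simp]: "rat_padic_abs p 0 = 0"
  by (simp add: rat_padic_abs_def)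

lemma rat_padic_abs_nonneg [simp]: "rat_padic_abs p x \<ge> 0"
  by (simp add: rat_padic_abs_def)

lemma rat_padic_abs_minus [simp]:
  assumes "prime p"
  shows "rat_padic_abs p (- x) = rat_padic_abs p x"
proof -
  obtain a b where x: "b \<noteq> 0" "x = of_int a / of_int b"
    by (rule rat_common_denominator[of x x])
  show ?thesis
  proof (cases "a = 0")
    case False
    then show ?thesis
      using rat_padic_val_divide[OF assms, of "- a" b] rat_padic_val_divide[OF assms, of a b] x
      by (simp add: rat_padic_abs_def)
  qed (simp add: x)
qed

lemma rat_padic_abs_mult:
  assumes "prime p"
  shows "rat_padic_abs p (x * y) = rat_padic_abs p x * rat_padic_abs p y"
proof -
  obtain a b n where n: "n \<noteq> 0" "x = of_int a / of_int n" "y = of_int b / of_int n"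
    by (rule rat_common_denominator)
  have p: "real p \<noteq> 0" using assms by (auto simp: prime_gt_0_nat)
  have P: "prime_elem (int p)" using assms by simp
  show ?thesis
  proof (cases "x = 0 \<or> y = 0")
    case False
    then have ab: "a \<noteq> 0" "b \<noteq> 0" using n by auto
    have xy: "x * y = of_int (a * b) / of_int (n * n)" by (simp add: n)
    have "rat_padic_val p (x * y) = rat_padic_val p x + rat_padic_val p y"
      using rat_padic_val_divide[OF assms, of "a * b" "n * n"]
        rat_padic_val_divide[OF assms, of a n] rat_padic_val_divide[OF assms, of b n]
        prime_elem_multiplicity_mult_distrib[OF P ab]
        prime_elem_multiplicity_mult_distrib[OF P n(1) n(1)] ab n(1)
      unfolding xy unfolding n(2,3) by (simp del: of_int_mult)
    then have "rat_padic_abs p (x * y) = real p powi (- rat_padic_val p x + - rat_padic_val p y)"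
      using False by (simp add: rat_padic_abs_def)
    also have "\<dots> = rat_padic_abs p x * rat_padic_abs p y"
      using False p by (subst power_int_add) (simp_all add: rat_padic_abs_def)
    finally show ?thesis .
  qed auto
qed

text \<open>Over a common denominator this says that the smaller of the two powers of
  \<open>p\<close> divides \<open>a + b\<close>. The zero cases are split off because
  \<open>rat_padic_val\<close> carries no meaning at 0.\<close>

lemma rat_padic_abs_add:
  assumes "prime p"
  shows "rat_padic_abs p (x + y) \<le> max (rat_padic_abs p x) (rat_padic_abs p y)"
proof (cases "x = 0 \<or> y = 0 \<or> x + y = 0")
  case False
  obtain a b n where n: "n \<noteq> 0" "x = of_int a / of_int n" "y = of_int b / of_int n"
    by (rule rat_common_denominator)
  have xy: "x + y = of_int (a + b) / of_int n" by (simp add: n add_divide_distrib)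
  have ab: "a \<noteq> 0" "b \<noteq> 0" using False n by auto
  have abn: "a + b \<noteq> 0" using False unfolding xy by auto
  have p: "real p > 1" using assms prime_gt_1_nat by auto
  let ?m = "min (multiplicity (int p) a) (multiplicity (int p) b)"
  have "int p ^ ?m dvd a + b"
    by (intro dvd_add multiplicity_dvd') auto
  then have "multiplicity (int p) (a + b) \<ge> ?m"
    using abn assms by (intro multiplicity_geI) auto
  then have "rat_padic_val p (x + y) \<ge> min (rat_padic_val p x) (rat_padic_val p y)"
    using rat_padic_val_divide[OF assms abn n(1)]
      rat_padic_val_divide[OF assms ab(1) n(1)] rat_padic_val_divide[OF assms ab(2) n(1)]
    unfolding xy unfolding n(2,3) by linarith
  then have "- rat_padic_val p (x + y) \<le> - rat_padic_val p x \<or> - rat_padic_val p (x + y) \<le> - rat_padic_val p y"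
    by linarith
  then have "real p powi (- rat_padic_val p (x + y)) \<le> real p powi (- rat_padic_val p x) \<or>
      real p powi (- rat_padic_val p (x + y)) \<le> real p powi (- rat_padic_val p y)"
    using p power_int_increasing[of _ _ "real p"] by fastforce
  then show ?thesis
    using False by (simp add: rat_padic_abs_def le_max_iff_disj)
qed (auto simp: le_max_iff_disj)

lemma rat_padic_abs_one [simp]: "rat_padic_abs p 1 = 1"
  by (simp add: rat_padic_abs_def rat_padic_val_def)

lemma rat_padic_abs_range: "x \<noteq> 0 \<Longrightarrow> \<exists>n. rat_padic_abs p x = real p powi n"
  by (auto simp: rat_padic_abs_def)

lemma rat_padic_abs_prime:
  assumes "prime p"
  shows "rat_padic_abs p (of_nat p) = 1 / real p"
  using rat_padic_val_divide[OF assms, of "int p" 1] assms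
  by (simp add: rat_padic_abs_def power_int_minus divide_inverse)

lemma rat_padic_abs_diff_commute:
  assumes "prime p"
  shows "rat_padic_abs p (x - y) = rat_padic_abs p (y - x)"
  using rat_padic_abs_minus[OF assms, of "x - y"] by simp

text \<open>Reverse triangle inequality. It makes the absolute values along a Cauchy sequence
  converge in the reals, and makes their limit independent of the representative.\<close>

lemma rat_padic_abs_diff_lipschitz:
  assumes "prime p"
  shows "\<bar>rat_padic_abs p x - rat_padic_abs p y\<bar> \<le> rat_padic_abs p (x - y)"
proof -
  have "rat_padic_abs p u \<le> rat_padic_abs p v + rat_padic_abs p (u - v)" for u v
    using rat_padic_abs_add[OF assms, of v "u - v"]
      rat_padic_abs_nonneg[of p "v"] rat_padic_abs_nonneg[of p "u - v"] by (simp del: rat_padic_abs_nonneg)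
  from this[of x y] this[of y x] show ?thesis
    using rat_padic_abs_diff_commute[OF assms, of x y] by linarith
qed

lemma rat_padic_abs_of_nat_power:
  assumes "prime p"
  shows "rat_padic_abs p (of_nat p ^ n) = (1 / real p) ^ n"
  by (induction n) (simp_all add: rat_padic_abs_mult[OF assms] rat_padic_abs_prime[OF assms])


section \<open>Cauchy sequences of rationals and the ideal of null sequences\<close>

locale padic =
  fixes p :: nat
  assumes prime: "prime p"
begin

abbreviation "v \<equiv> rat_padic_abs p"
abbreviation "C \<equiv> padic_cauchy_ring p"
abbreviation "I \<equiv> padic_null_ideal p"

lemma p_gt_1: "real p > 1"
  using prime_gt_1_nat[OF prime] by simp

lemmas v_mult = rat_padic_abs_mult[OF prime]
  and v_add = rat_padic_abs_add[OF prime]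
  and v_minus = rat_padic_abs_minus[OF prime]

lemma cauchy_iff: "x \<in> carrier C \<longleftrightarrow> (\<forall>e>0. \<exists>N. \<forall>m\<ge>N. \<forall>n\<ge>N. v (x m - x n) < e)"
  by (simp add: padic_cauchy_ring_def)

lemma C_simps [simp]:
  "x \<otimes>\<^bsub>C\<^esub> y = (\<lambda>n. x n * y n)" "\<one>\<^bsub>C\<^esub> = (\<lambda>n. 1)"
  "x \<oplus>\<^bsub>C\<^esub> y = (\<lambda>n. x n + y n)" "\<zero>\<^bsub>C\<^esub> = (\<lambda>n. 0)"
  by (simp_all add: padic_cauchy_ring_def)

lemma cauchy_const: "(\<lambda>n. c) \<in> carrier C"
  by (auto simp: cauchy_iff)

lemma cauchy_abs_convergent:
  assumes "x \<in> carrier C"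
  shows "convergent (\<lambda>n. v (x n))"
proof -
  have "Cauchy (\<lambda>n. v (x n))"
  proof (rule metric_CauchyI)
    fix e :: real assume "e > 0"
    then obtain N where "\<forall>m\<ge>N. \<forall>n\<ge>N. v (x m - x n) < e"
      using assms by (auto simp: cauchy_iff)
    then show "\<exists>M. \<forall>m\<ge>M. \<forall>n\<ge>M. dist (v (x m)) (v (x n)) < e"
      using rat_padic_abs_diff_lipschitz[OF prime] unfolding dist_real_def by (meson le_less_trans)
  qed
  then show ?thesis by (rule Cauchy_convergent)
qed

lemma cauchy_bounded:
  assumes "x \<in> carrier C"
  obtains B where "B > 0" "\<And>n. v (x n) \<le> B"
  using convergent_imp_Bseq[OF cauchy_abs_convergent[OF assms]]
  unfolding Bseq_def by auto

lemma cauchy_add: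
  assumes "x \<in> carrier C" "y \<in> carrier C"
  shows "(\<lambda>n. x n + y n) \<in> carrier C"
  unfolding cauchy_iff
proof (intro allI impI)
  fix e :: real assume "e > 0"
  then obtain M N where M: "\<forall>m\<ge>M. \<forall>n\<ge>M. v (x m - x n) < e" and N: "\<forall>m\<ge>N. \<forall>n\<ge>N. v (y m - y n) < e"
    using assms unfolding cauchy_iff by blast
  have "v (x m + y m - (x n + y n)) < e" if "m \<ge> max M N" "n \<ge> max M N" for m n
  proof -
    have "v ((x m - x n) + (y m - y n)) < e"
      using v_add[of "x m - x n" "y m - y n"] M N that by (smt (verit) max.bounded_iff)
    then show ?thesis by (simp add: algebra_simps)
  qed
  then show "\<exists>N. \<forall>m\<ge>N. \<forall>n\<ge>N. v (x m + y m - (x n + y n)) < e" by blast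
qed

lemma cauchy_uminus:
  assumes "x \<in> carrier C"
  shows "(\<lambda>n. - x n) \<in> carrier C"
proof -
  have "v (- x m - - x n) = v (x m - x n)" for m n
    using v_minus[of "x m - x n"] by simp
  then show ?thesis using assms by (simp add: cauchy_iff)
qed

lemma cauchy_mult:
  assumes "x \<in> carrier C" "y \<in> carrier C"
  shows "(\<lambda>n. x n * y n) \<in> carrier C"
  unfolding cauchy_iff
proof (intro allI impI)
  fix e :: real assume e: "e > 0"
  obtain A where A: "A > 0" "\<And>n. v (x n) \<le> A" using cauchy_bounded[OF assms(1)] by blast
  obtain B where B: "B > 0" "\<And>n. v (y n) \<le> B" using cauchy_bounded[OF assms(2)] by blast
  have "e / B > 0" "e / A > 0" using e A B by auto
  then obtain M N where M: "\<forall>m\<ge>M. \<forall>n\<ge>M. v (x m - x n) < e / B" and N: "\<forall>m\<ge>N. \<forall>n\<ge>N. v (y m - y n) < e / A"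
    using assms unfolding cauchy_iff by blast
  have "v (x m * y m - x n * y n) < e" if mn: "m \<ge> max M N" "n \<ge> max M N" for m n
  proof -
    have eq: "x m * y m - x n * y n = (x m - x n) * y m + x n * (y m - y n)"
      by (simp add: algebra_simps)
    have "v ((x m - x n) * y m) < e / B * B"
      unfolding v_mult using M mn B by (intro mult_strict_right_mono le_less_trans[OF mult_left_mono[OF B(2)]]) auto
    moreover have "v (x n * (y m - y n)) < A * (e / A)"
      unfolding v_mult using N mn A
      by (intro le_less_trans[OF mult_right_mono[OF A(2)]] mult_strict_left_mono) auto
    ultimately show ?thesis
      unfolding eq using v_add[of "(x m - x n) * y m" "x n * (y m - y n)"] A B by auto
  qed
  then show "\<exists>N. \<forall>m\<ge>N. \<forall>n\<ge>N. v (x m * y m - x n * y n) < e" by blast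
qed

lemma null_iff: "x \<in> I \<longleftrightarrow> (\<lambda>n. v (x n)) \<longlonglongrightarrow> 0"
  by (simp add: padic_null_ideal_def)

lemma null_cauchy:
  assumes "x \<in> I"
  shows "x \<in> carrier C"
  unfolding cauchy_iff
proof (intro allI impI)
  fix e :: real assume "e > 0"
  then obtain N where N: "\<forall>n\<ge>N. v (x n) < e"
    using assms unfolding null_iff LIMSEQ_iff by auto
  have "v (x m - x n) < e" if "m \<ge> N" "n \<ge> N" for m n
    using v_add[of "x m" "- x n"] N that v_minus[of "x n"] by (smt (verit) diff_conv_add_uminus)
  then show "\<exists>N. \<forall>m\<ge>N. \<forall>n\<ge>N. v (x m - x n) < e" by blast
qed

lemma null_add:
  assumes "x \<in> I" "y \<in> I"
  shows "(\<lambda>n. x n + y n) \<in> I"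
  unfolding null_iff
proof (rule tendsto_sandwich[OF _ _ tendsto_const])
  show "(\<lambda>n. v (x n) + v (y n)) \<longlonglongrightarrow> 0"
    using tendsto_add[of _ 0 _ _ 0] assms by (simp add: null_iff)
  show "\<forall>\<^sub>F n in sequentially. v (x n + y n) \<le> v (x n) + v (y n)"
  proof (intro always_eventually allI)
    fix n
    show "v (x n + y n) \<le> v (x n) + v (y n)"
      using v_add[of "x n" "y n"] rat_padic_abs_nonneg[of p "x n"] rat_padic_abs_nonneg[of p "y n"] by linarith
  qed
qed simp

lemma null_mult:
  assumes "x \<in> I" "y \<in> carrier C"
  shows "(\<lambda>n. x n * y n) \<in> I"
proof -
  obtain B where B: "B > 0" "\<And>n. v (y n) \<le> B" using cauchy_bounded[OF assms(2)] by blast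
  have "Bseq (\<lambda>n. v (y n))" by (rule BseqI'[of _ B]) (simp add: B)
  then have "Zfun (\<lambda>n. v (x n) * v (y n)) sequentially"
    using assms(1) unfolding null_iff tendsto_Zfun_iff
    by (intro bounded_bilinear.Zfun_prod_Bfun[OF bounded_bilinear_mult]) auto
  then show ?thesis by (simp add: null_iff v_mult tendsto_Zfun_iff)
qed

lemma cring_cauchy: "cring C"
proof (rule cringI)
  show "abelian_group C"
  proof (rule abelian_groupI)
    show "\<exists>y\<in>carrier C. y \<oplus>\<^bsub>C\<^esub> x = \<zero>\<^bsub>C\<^esub>" if "x \<in> carrier C" for x
      using cauchy_uminus[OF that] by (intro bexI) auto
  qed (use cauchy_add cauchy_const in \<open>auto simp: add_ac\<close>)
  show "Group.comm_monoid C"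
    by (rule comm_monoidI) (use cauchy_mult cauchy_const in \<open>auto simp: mult_ac\<close>)
qed (auto simp: algebra_simps)

lemma ideal_null: "ideal I C"
proof (rule idealI)
  interpret C: cring C by (rule cring_cauchy)
  show "ring C" by (rule C.ring_axioms)
  show "subgroup I (add_monoid C)"
  proof (rule group.subgroupI[OF C.a_group])
    show "I \<noteq> {}" unfolding padic_null_ideal_def by (auto intro!: exI[of _ "\<lambda>n. 0"])
    show "inv\<^bsub>add_monoid C\<^esub> a \<in> I" if "a \<in> I" for a
    proof -
      have "\<ominus>\<^bsub>C\<^esub> a = (\<lambda>n. - a n)"
        using C.minus_equality[of "\<lambda>n. - a n" a] null_cauchy[OF that] cauchy_uminus[of a] by auto
      then show ?thesis using that by (simp add: a_inv_def null_iff v_minus)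
    qed
  qed (use null_cauchy null_add in auto)
qed (use null_mult in \<open>auto simp: mult.commute\<close>)

sublocale C: cring C by (rule cring_cauchy)

sublocale I: ideal I C by (rule ideal_null)

section \<open>The quotient ring \<open>Qp p\<close> and the extension of the absolute value to
  it\<close>

sublocale Q: cring "Qp p"
  unfolding Qp_def by (rule I.quotient_is_cring[OF cring_cauchy])

definition cls :: "(nat \<Rightarrow> rat) \<Rightarrow> padic" where
  "cls x = I +>\<^bsub>C\<^esub> x"

sublocale cls: ring_hom_cring C "Qp p" cls
proof -
  have "cls = (+>\<^bsub>C\<^esub>) I" by (auto simp: cls_def)
  then show "ring_hom_cring C (Qp p) cls"
    unfolding Qp_def using I.rcos_ring_hom_cring[OF cring_cauchy] by simp
qed

lemma C_uminus: "x \<in> carrier C \<Longrightarrow> \<ominus>\<^bsub>C\<^esub> x = (\<lambda>n. - x n)"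
  using C.minus_equality[of "\<lambda>n. - x n" x] cauchy_uminus[of x] by auto

lemma carrier_Qp: "carrier (Qp p) = cls ` carrier C"
  unfolding Qp_def FactRing_def A_RCOSETS_def RCOSETS_def cls_def a_r_coset_def by auto

lemma cls_one: "cls (\<lambda>n. 1) = \<one>\<^bsub>Qp p\<^esub>"
  using cls.hom_one by simp

lemma cls_zero: "cls (\<lambda>n. 0) = \<zero>\<^bsub>Qp p\<^esub>"
  using cls.hom_zero by simp

lemma cls_mult:
  "x \<in> carrier C \<Longrightarrow> y \<in> carrier C \<Longrightarrow> cls (\<lambda>n. x n * y n) = cls x \<otimes>\<^bsub>Qp p\<^esub> cls y"
  using cls.hom_mult[of x y] by simp

lemma cls_add:
  "x \<in> carrier C \<Longrightarrow> y \<in> carrier C \<Longrightarrow> cls (\<lambda>n. x n + y n) = cls x \<oplus>\<^bsub>Qp p\<^esub> cls y"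
  using cls.hom_add[of x y] by simp

lemma cls_uminus: "x \<in> carrier C \<Longrightarrow> cls (\<lambda>n. - x n) = \<ominus>\<^bsub>Qp p\<^esub> cls x"
  using cls.hom_a_inv[of x] by (simp add: C_uminus)

lemma cls_surj:
  assumes "X \<in> carrier (Qp p)"
  obtains x where "x \<in> carrier C" "X = cls x"
  using assms carrier_Qp by auto

text \<open>Justifies the definite description in \<open>padic_abs\<close>: a limit exists by
  completeness of the reals, and two representatives of a class differ by a null sequence, which
  cannot change the limit.\<close>

lemma padic_abs_cls:
  assumes "x \<in> carrier C"
  shows "(\<lambda>n. v (x n)) \<longlonglongrightarrow> padic_abs p (cls x)"
proof -
  obtain r where r: "(\<lambda>n. v (x n)) \<longlonglongrightarrow> r"
    using cauchy_abs_convergent[OF assms] by (auto simp: convergent_def)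
  have "padic_abs p (cls x) = r"
    unfolding padic_abs_def
  proof (rule the_equality)
    show "\<exists>y\<in>cls x. (\<lambda>n. v (y n)) \<longlonglongrightarrow> r"
      using r I.a_rcos_self[OF assms] by (auto simp: cls_def)
    fix s assume "\<exists>y\<in>cls x. (\<lambda>n. v (y n)) \<longlonglongrightarrow> s"
    then obtain y where y: "y \<in> cls x" "(\<lambda>n. v (y n)) \<longlonglongrightarrow> s" by blast
    then obtain h where h: "h \<in> I" "y = (\<lambda>n. h n + x n)"
      by (auto simp: cls_def a_r_coset_def r_coset_def)
    have "(\<lambda>n. v (y n) - v (x n)) \<longlonglongrightarrow> 0"
    proof (rule Lim_null_comparison)
      show "(\<lambda>n. v (h n)) \<longlonglongrightarrow> 0" using h by (simp add: null_iff)
      show "\<forall>\<^sub>F n in sequentially. norm (v (y n) - v (x n)) \<le> v (h n)"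
      proof (intro always_eventually allI)
        fix n
        show "norm (v (y n) - v (x n)) \<le> v (h n)"
          using rat_padic_abs_diff_lipschitz[OF prime, of "y n" "x n"] by (simp add: h)
      qed
    qed
    moreover have "(\<lambda>n. v (y n) - v (x n)) \<longlonglongrightarrow> s - r"
      by (intro tendsto_diff y r)
    ultimately show "s = r" using LIMSEQ_unique by fastforce
  qed
  with r show ?thesis by simp
qed

lemma padic_abs_clsI:
  assumes "x \<in> carrier C" "(\<lambda>n. v (x n)) \<longlonglongrightarrow> r"
  shows "padic_abs p (cls x) = r"
  using padic_abs_cls[OF assms(1)] assms(2) LIMSEQ_unique by blast

lemma padic_abs_nonneg: "X \<in> carrier (Qp p) \<Longrightarrow> padic_abs p X \<ge> 0"
  by (elim cls_surj) (auto intro!: LIMSEQ_le_const[OF padic_abs_cls])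

lemma padic_abs_one: "padic_abs p \<one>\<^bsub>Qp p\<^esub> = 1"
  unfolding cls_one[symmetric] by (rule padic_abs_clsI) (simp_all add: cauchy_const)

lemma padic_abs_zero: "padic_abs p \<zero>\<^bsub>Qp p\<^esub> = 0"
  unfolding cls_zero[symmetric] by (rule padic_abs_clsI) (simp_all add: cauchy_const)

lemma padic_abs_mult:
  assumes "X \<in> carrier (Qp p)" "Y \<in> carrier (Qp p)"
  shows "padic_abs p (X \<otimes>\<^bsub>Qp p\<^esub> Y) = padic_abs p X * padic_abs p Y"
proof -
  obtain x y where x: "x \<in> carrier C" "X = cls x" and y: "y \<in> carrier C" "Y = cls y"
    by (metis assms cls_surj)
  have "padic_abs p (cls (\<lambda>n. x n * y n)) = padic_abs p X * padic_abs p Y"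
    unfolding x y v_mult
    by (intro padic_abs_clsI cauchy_mult x(1) y(1))
      (simp add: v_mult tendsto_mult padic_abs_cls x(1) y(1))
  then show ?thesis using x y by (simp add: cls_mult)
qed

lemma padic_abs_add:
  assumes "X \<in> carrier (Qp p)" "Y \<in> carrier (Qp p)"
  shows "padic_abs p (X \<oplus>\<^bsub>Qp p\<^esub> Y) \<le> max (padic_abs p X) (padic_abs p Y)"
proof -
  obtain x y where x: "x \<in> carrier C" "X = cls x" and y: "y \<in> carrier C" "Y = cls y"
    by (metis assms cls_surj)
  have "padic_abs p (cls (\<lambda>n. x n + y n)) \<le> max (padic_abs p X) (padic_abs p Y)"
    unfolding x y
    by (rule LIMSEQ_le[OF padic_abs_cls tendsto_max[OF padic_abs_cls padic_abs_cls]])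
      (use x y v_add cauchy_add in auto)
  then show ?thesis using x y by (simp add: cls_add)
qed

lemma padic_abs_minus:
  assumes "X \<in> carrier (Qp p)"
  shows "padic_abs p (\<ominus>\<^bsub>Qp p\<^esub> X) = padic_abs p X"
proof -
  obtain x where x: "x \<in> carrier C" "X = cls x" by (rule cls_surj[OF assms])
  have "padic_abs p (cls (\<lambda>n. - x n)) = padic_abs p X"
    by (rule padic_abs_clsI) (use x padic_abs_cls cauchy_uminus in \<open>simp_all add: v_minus\<close>)
  then show ?thesis using x by (simp add: cls_uminus)
qed

lemma padic_abs_mult_inv:
  assumes "X \<in> Units (Qp p)"
  shows "padic_abs p X * padic_abs p (inv\<^bsub>Qp p\<^esub> X) = 1"
  using padic_abs_mult[of X "inv\<^bsub>Qp p\<^esub> X"] assms by (simp add: Q.Units_closed padic_abs_one)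

lemma padic_abs_unit_pos:
  assumes "X \<in> Units (Qp p)"
  shows "padic_abs p X > 0"
proof -
  have "padic_abs p X \<noteq> 0" using padic_abs_mult_inv[OF assms] by auto
  then show ?thesis using padic_abs_nonneg[OF Q.Units_closed[OF assms]] by linarith
qed

lemma padic_abs_inv:
  "X \<in> Units (Qp p) \<Longrightarrow> padic_abs p (inv\<^bsub>Qp p\<^esub> X) = inverse (padic_abs p X)"
  using inverse_unique[OF padic_abs_mult_inv] by simp

lemma padic_abs_pow: "X \<in> carrier (Qp p) \<Longrightarrow> padic_abs p (X [^]\<^bsub>Qp p\<^esub> (n::nat)) = padic_abs p X ^ n"
  by (induction n) (simp_all add: padic_abs_one padic_abs_mult)

text \<open>Completion does not enlarge the value group: along a Cauchy sequence with nonzero limit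
  the absolute values are eventually constant, so the limit is already the absolute value of a
  rational.\<close>

lemma padic_abs_unit_range:
  assumes "X \<in> Units (Qp p)"
  shows "\<exists>n. padic_abs p X = real p powi n"
proof -
  obtain x where x: "x \<in> carrier C" "X = cls x" by (rule cls_surj[OF Q.Units_closed[OF assms]])
  let ?r = "padic_abs p X"
  have r: "?r > 0" by (rule padic_abs_unit_pos[OF assms])
  have lim: "(\<lambda>n. v (x n)) \<longlonglongrightarrow> ?r" unfolding x by (rule padic_abs_cls[OF x(1)])
  obtain M where M: "\<forall>n\<ge>M. v (x n) > ?r / 2"
    using order_tendstoD(1)[OF lim, of "?r / 2"] r unfolding eventually_sequentially by auto
  obtain N where N: "\<forall>m\<ge>N. \<forall>n\<ge>N. v (x m - x n) < ?r / 2"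
    using x(1) half_gt_zero[OF r] unfolding cauchy_iff by blast
  define K where "K = max M N"
  have "v (x n) = v (x K)" if "n \<ge> K" for n
  proof -
    have d: "v (x n - x K) < ?r / 2" "v (x K - x n) < ?r / 2" using N that by (auto simp: K_def)
    have "v (x n) > ?r / 2" "v (x K) > ?r / 2" using M that by (auto simp: K_def)
    \<comment> \<open>Both terms exceed r/2 and their difference stays below r/2, so the ultrametric
      inequality, applied in both directions, forces equality.\<close>
    then show ?thesis
      using v_add[of "x K" "x n - x K"] v_add[of "x n" "x K - x n"] d
      by (simp add: le_max_iff_disj)
  qed
  then have "(\<lambda>n. v (x n)) \<longlonglongrightarrow> v (x K)"
    by (intro tendsto_eventually) (use eventually_sequentially in blast)
  then have "?r = v (x K)" using lim LIMSEQ_unique by blast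
  moreover from this have "x K \<noteq> 0" using r by auto
  ultimately show ?thesis using rat_padic_abs_range[of "x K" p] by simp
qed

text \<open>The class of the constant sequence \<open>p ^ n\<close>; these units provide the
  translations between cells.\<close>

lemma padic_unit_of_abs: "\<exists>X\<in>Units (Qp p). padic_abs p X = (1 / real p) ^ n"
proof -
  let ?x = "\<lambda>_::nat. of_nat p ^ n :: rat" and ?y = "\<lambda>_::nat. 1 / of_nat p ^ n :: rat"
  have p: "(of_nat p :: rat) \<noteq> 0" using p_gt_1 by auto
  then have "cls ?x \<otimes>\<^bsub>Qp p\<^esub> cls ?y = \<one>\<^bsub>Qp p\<^esub>"
    by (subst cls_mult[symmetric]) (simp_all add: cauchy_const cls_one)
  then have "cls ?x \<in> Units (Qp p)"
    using Q.m_comm[of "cls ?x" "cls ?y"] cls.hom_closed[OF cauchy_const]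
    unfolding Units_def by force
  moreover have "padic_abs p (cls ?x) = (1 / real p) ^ n"
    by (intro padic_abs_clsI cauchy_const) (simp add: rat_padic_abs_of_nat_power[OF prime])
  ultimately show ?thesis by blast
qed

end

section \<open>The representation of the torus\<close>

lemma (in ring) finsum_diag_mult:
  assumes "finite S" "i \<in> S" "a \<in> carrier R" "b \<in> S \<rightarrow> carrier R"
  shows "(\<Oplus>l\<in>S. (if i = l then a else \<zero>) \<otimes> b l) = a \<otimes> b i"
proof -
  have "(\<Oplus>l\<in>S. (if i = l then a else \<zero>) \<otimes> b l) = (\<Oplus>l\<in>S. if i = l then a \<otimes> b l else \<zero>)"
    using assms funcset_mem[OF assms(4)] by (intro finsum_cong') auto
  also have "\<dots> = a \<otimes> b i"
    using assms funcset_mem[OF assms(4)] by (intro add.finprod_singleton) auto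
  finally show ?thesis .
qed

lemma (in cring) finprod_eq_zero:
  assumes "finite S" "i \<in> S" "f i = \<zero>" "f \<in> S \<rightarrow> carrier R"
  shows "finprod R f S = \<zero>"
proof -
  have "finprod R f (insert i (S - {i})) = f i \<otimes> finprod R f (S - {i})"
    using assms by (intro finprod_insert) auto
  moreover have "finprod R f (S - {i}) \<in> carrier R"
    using assms(4) by (intro finprod_closed) auto
  ultimately show ?thesis using assms by (simp add: insert_absorb)
qed

text \<open>Every permutation other than the identity moves some index and so picks an off-diagonal
  zero.\<close>

lemma (in cring) mat_det_diag:
  assumes "c \<in> {1..n} \<rightarrow> carrier R"
  shows "mat_det n R (\<lambda>i j. if i = j then c i else \<zero>) = finprod R c {1..n}"
proof -
  let ?P = "{\<sigma>. \<sigma> permutes {1..n}}"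
  let ?A = "\<lambda>i j. if i = j then c i else \<zero>"
  have "add_pow R (sign \<sigma> :: int) (finprod R (\<lambda>i. ?A i (\<sigma> i)) {1..n}) =
      (if id = \<sigma> then finprod R c {1..n} else \<zero>)" if "\<sigma> \<in> ?P" for \<sigma>
  proof (cases "\<sigma> = id")
    case True
    have "finprod R (\<lambda>i. ?A i (id i)) {1..n} = finprod R c {1..n}"
      by (rule finprod_cong') (use assms in auto)
    moreover have "finprod R c {1..n} \<in> carrier R"
      using assms by (rule finprod_closed)
    ultimately show ?thesis
      using True add.int_pow_1 by (simp add: sign_id)
  next
    case False
    then obtain i where i: "\<sigma> i \<noteq> i" by (auto simp: fun_eq_iff)
    then have "i \<in> {1..n}" using that permutes_not_in by fastforce
    then have "finprod R (\<lambda>i. ?A i (\<sigma> i)) {1..n} = \<zero>"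
      using i assms by (intro finprod_eq_zero[of _ i]) auto
    then show ?thesis using False add.int_pow_one by simp
  qed
  then have "mat_det n R ?A = (\<Oplus>\<sigma>\<in>?P. if id = \<sigma> then finprod R c {1..n} else \<zero>)"
    unfolding mat_det_def using finprod_closed[OF assms] by (intro finsum_cong') auto
  also have "\<dots> = finprod R c {1..n}"
    using finprod_closed[OF assms] by (intro add.finprod_singleton) (auto simp: permutes_id finite_permutations)
  finally show ?thesis .
qed

lemma rho_eq_diag: "rho d k R x = (\<lambda>i j. if i = j then rho d k R x i i else \<zero>\<^bsub>R\<^esub>)"
  by (auto simp: rho_def fun_eq_iff)

lemma carrier_torus: "carrier (torus d R) = PiE {1..d} (\<lambda>_. Units R)"
  by (simp add: torus_def units_of_carrier)

lemma mult_torus: "x \<otimes>\<^bsub>torus d R\<^esub> y = (\<lambda>i\<in>{1..d}. x i \<otimes>\<^bsub>R\<^esub> y i)"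
  by (simp add: torus_def units_of_mult)

context padic
begin

lemma padic_abs_finprod:
  assumes "c \<in> S \<rightarrow> carrier (Qp p)"
  shows "padic_abs p (finprod (Qp p) c S) = (\<Prod>i\<in>S. padic_abs p (c i))"
  using assms
proof (induction S rule: infinite_finite_induct)
  case (insert a S)
  then have "finprod (Qp p) c (insert a S) = c a \<otimes>\<^bsub>Qp p\<^esub> finprod (Qp p) c S"
    by (intro Q.finprod_insert) auto
  moreover have "finprod (Qp p) c S \<in> carrier (Qp p)"
    using insert by (intro Q.finprod_closed) auto
  ultimately show ?case using insert by (simp add: padic_abs_mult)
qed (simp_all add: padic_abs_one Q.finprod_infinite)

section \<open>Integrality and invertibility of the diagonal matrices
  \<open>rho d k (Qp p) g\<close>\<close>

lemma Zp_carrier: "carrier (Zp p) = {x \<in> carrier (Qp p). padic_abs p x \<le> 1}"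
  by (simp add: Zp_def)

lemma Zp_simps [simp]:
  "\<one>\<^bsub>Zp p\<^esub> = \<one>\<^bsub>Qp p\<^esub>" "\<zero>\<^bsub>Zp p\<^esub> = \<zero>\<^bsub>Qp p\<^esub>" "x \<otimes>\<^bsub>Zp p\<^esub> y = x \<otimes>\<^bsub>Qp p\<^esub> y"
  by (simp_all add: Zp_def)

lemma Zp_add [simp]: "x \<oplus>\<^bsub>Zp p\<^esub> y = x \<oplus>\<^bsub>Qp p\<^esub> y"
  by (simp add: Zp_def)

text \<open>The matrix products in \<open>GL n (Zp p)\<close> are finite sums taken with the carrier
  of \<open>Zp p\<close>, so they are evaluated inside this ring instead of being transferred from
  \<open>Qp p\<close>. Closure under addition is the ultrametric inequality.\<close>

lemma ring_Zp: "ring (Zp p)"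
proof (rule ringI)
  have mult: "x \<otimes>\<^bsub>Qp p\<^esub> y \<in> carrier (Zp p)" and add: "x \<oplus>\<^bsub>Qp p\<^esub> y \<in> carrier (Zp p)"
    if "x \<in> carrier (Zp p)" "y \<in> carrier (Zp p)" for x y
    using that padic_abs_add[of x y]
    by (auto simp: Zp_carrier padic_abs_mult padic_abs_nonneg intro!: mult_le_one)
  have sub: "x \<in> carrier (Qp p)" if "x \<in> carrier (Zp p)" for x
    using that by (simp add: Zp_carrier)
  show "abelian_group (Zp p)"
  proof (rule abelian_groupI)
    show "\<exists>y\<in>carrier (Zp p). y \<oplus>\<^bsub>Zp p\<^esub> x = \<zero>\<^bsub>Zp p\<^esub>" if "x \<in> carrier (Zp p)" for x
      using that by (intro bexI[of _ "\<ominus>\<^bsub>Qp p\<^esub> x"]) (auto simp: Zp_carrier padic_abs_minus Q.l_neg)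
  qed (simp_all add: add sub Q.a_ac, simp add: Zp_carrier padic_abs_zero)
  show "Group.monoid (Zp p)"
    by (rule monoidI) (auto simp: mult sub Q.m_assoc, simp add: Zp_carrier padic_abs_one)
qed (auto simp: Zp_carrier Q.l_distr Q.r_distr)

lemma diag_in_GL_Zp_iff:
  assumes "\<And>i. i \<in> {1..n} \<Longrightarrow> c i \<in> Units (Qp p)"
  shows "(\<lambda>i j. if i = j then c i else \<zero>\<^bsub>Qp p\<^esub>) \<in> GL n (Zp p) \<longleftrightarrow> (\<forall>i\<in>{1..n}. padic_abs p (c i) = 1)"
    (is "?A \<in> _ \<longleftrightarrow> _")
proof -
  interpret Z: ring "Zp p" by (rule ring_Zp)
  have diag: "finsum (Zp p) (\<lambda>l. (if i = l then e i else \<zero>\<^bsub>Qp p\<^esub>) \<otimes>\<^bsub>Qp p\<^esub> B l j) {1..n} = e i \<otimes>\<^bsub>Qp p\<^esub> B i j"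
    if "B \<in> matrices n (Zp p)" "i \<in> {1..n}" "j \<in> {1..n}" "e i \<in> carrier (Zp p)" for B i j e
  proof -
    have "(\<lambda>l. B l j) \<in> {1..n} \<rightarrow> carrier (Zp p)" using that by (auto simp: matrices_def)
    then show ?thesis
      using Z.finsum_diag_mult[of "{1..n}" i "e i" "\<lambda>l. B l j"] that
      unfolding Zp_simps by blast
  qed
  show ?thesis
  proof
    assume "?A \<in> GL n (Zp p)"
    then obtain B where A: "?A \<in> matrices n (Zp p)" and B: "B \<in> matrices n (Zp p)"
      and inv: "mutually_inverse n (Zp p) ?A B"
      by (auto simp: GL_def)
    show "\<forall>i\<in>{1..n}. padic_abs p (c i) = 1"
    proof
      fix i assume i: "i \<in> {1..n}"
      have c: "c i \<in> carrier (Zp p)" using A i by (auto simp: matrices_def split: if_splits)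
      have b: "B i i \<in> carrier (Zp p)" using B i by (auto simp: matrices_def)
      have "c i \<otimes>\<^bsub>Qp p\<^esub> B i i = \<one>\<^bsub>Qp p\<^esub>"
        using inv i diag[OF B i i, of c, OF c] by (simp add: mutually_inverse_def)
      then have "padic_abs p (c i) * padic_abs p (B i i) = 1"
        using c b padic_abs_mult[of "c i" "B i i"] by (simp add: Zp_carrier padic_abs_one)
      \<comment> \<open>Two absolute values that are at most 1 and have product 1 are both
        1.\<close>
      moreover have "padic_abs p (c i) * padic_abs p (B i i) \<le> padic_abs p (c i) * 1"
        using c b by (intro mult_left_mono) (auto simp: Zp_carrier padic_abs_nonneg)
      ultimately show "padic_abs p (c i) = 1" using c by (simp add: Zp_carrier)
    qed
  next
    assume one: "\<forall>i\<in>{1..n}. padic_abs p (c i) = 1"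
    define b where "b i = inv\<^bsub>Qp p\<^esub> c i" for i
    let ?B = "\<lambda>i j. if i = j then b i else \<zero>\<^bsub>Qp p\<^esub>"
    have cb: "c i \<in> carrier (Zp p)" "b i \<in> carrier (Zp p)"
      "c i \<otimes>\<^bsub>Qp p\<^esub> b i = \<one>\<^bsub>Qp p\<^esub>" "b i \<otimes>\<^bsub>Qp p\<^esub> c i = \<one>\<^bsub>Qp p\<^esub>" if "i \<in> {1..n}" for i
      using one assms that by (auto simp: Zp_carrier b_def padic_abs_inv Q.Units_closed)
    have Zc: "\<zero>\<^bsub>Qp p\<^esub> \<in> carrier (Zp p)" by (simp add: Zp_carrier padic_abs_zero)
    then have AB: "?A \<in> matrices n (Zp p)" "?B \<in> matrices n (Zp p)" using cb by (auto simp: matrices_def)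
    have "mutually_inverse n (Zp p) ?A ?B"
      unfolding mutually_inverse_def
    proof (intro ballI conjI)
      fix i j assume ij: "i \<in> {1..n}" "j \<in> {1..n}"
      have Qc: "c i \<in> carrier (Qp p)" "b i \<in> carrier (Qp p)" using cb[OF ij(1)] by (auto simp: Zp_carrier)
      show "finsum (Zp p) (\<lambda>l. ?A i l \<otimes>\<^bsub>Zp p\<^esub> ?B l j) {1..n} = (if i = j then \<one>\<^bsub>Zp p\<^esub> else \<zero>\<^bsub>Zp p\<^esub>)"
        using diag[OF AB(2) ij, of c, OF cb(1)] ij Qc cb(3)[OF ij(1)] by auto
      show "finsum (Zp p) (\<lambda>l. ?B i l \<otimes>\<^bsub>Zp p\<^esub> ?A l j) {1..n} = (if i = j then \<one>\<^bsub>Zp p\<^esub> else \<zero>\<^bsub>Zp p\<^esub>)"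
        using diag[OF AB(1) ij, of b, OF cb(2)] ij Qc cb(4)[OF ij(1)] by auto
    qed
    with AB show "?A \<in> GL n (Zp p)" by (auto simp: GL_def)
  qed
qed

lemma Units_pow_closed: "x \<in> Units (Qp p) \<Longrightarrow> x [^]\<^bsub>Qp p\<^esub> (n::nat) \<in> Units (Qp p)"
  by (induction n) simp_all

lemma rho_diag_unit:
  assumes "d \<ge> 1" "g \<in> carrier (torus d (Qp p))" "i \<in> {1..2 * d - 1}"
  shows "rho d k (Qp p) g i i \<in> Units (Qp p)"
proof -
  have U: "g j \<in> Units (Qp p)" if "j \<in> {1..d}" for j
    using assms(2) that by (auto simp: carrier_torus PiE_iff)
  have "i - d \<in> {1..d}" if "\<not> i \<le> d" using that assms by auto
  then show ?thesis
    using assms U by (auto simp: rho_def intro!: Q.Units_m_closed Units_pow_closed)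
qed

lemma padic_abs_rho_low:
  assumes "i \<in> {1..d}"
  shows "padic_abs p (rho d k (Qp p) g i i) = padic_abs p (g i)"
  using assms by (simp add: rho_def)

lemma padic_abs_rho_high:
  assumes "g \<in> carrier (torus d (Qp p))" "i \<in> {1..d - 1}"
  shows "padic_abs p (rho d k (Qp p) g (d + i) (d + i)) = padic_abs p (g i) ^ k / padic_abs p (g d)"
proof -
  have "g i \<in> Units (Qp p)" "g d \<in> Units (Qp p)" using assms by (auto simp: carrier_torus PiE_iff)
  then show ?thesis
    using assms by (simp add: rho_def padic_abs_mult padic_abs_pow padic_abs_inv Q.Units_closed divide_inverse)
qed

lemma index_split:
  fixes d :: nat
  assumes "d \<ge> 1"
  shows "{1..2 * d - 1} = {1..d} \<union> (+) d ` {1..d - 1}"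
proof -
  have "{1..2 * d - 1} = {1..d} \<union> {d + 1..d + (d - 1)}" using assms by auto
  then show ?thesis by (simp only: image_add_atLeastAtMost add.commute[of _ d])
qed

text \<open>If all coordinates have absolute value 1, so do the quotients of \<open>g i ^ k\<close>
  by \<open>g d\<close>. Hence the set that normalizes the measure is the cell of valuation vector
  0.\<close>

lemma rho_in_GL_Zp_iff:
  assumes "d \<ge> 1" "g \<in> carrier (torus d (Qp p))"
  shows "rho d k (Qp p) g \<in> GL (2 * d - 1) (Zp p) \<longleftrightarrow> (\<forall>i\<in>{1..d}. padic_abs p (g i) = 1)"
proof -
  have "rho d k (Qp p) g \<in> GL (2 * d - 1) (Zp p) \<longleftrightarrow>
      (\<forall>i\<in>{1..2 * d - 1}. padic_abs p (rho d k (Qp p) g i i) = 1)"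
    by (subst rho_eq_diag, rule diag_in_GL_Zp_iff) (rule rho_diag_unit[OF assms])
  also have "\<dots> \<longleftrightarrow> (\<forall>i\<in>{1..d}. padic_abs p (g i) = 1)"
    unfolding index_split[OF assms(1)] ball_Un ball_simps
    using assms by (auto simp: padic_abs_rho_low padic_abs_rho_high)
  finally show ?thesis .
qed

lemma G_plus_iff:
  assumes "d \<ge> 1" "g \<in> carrier (torus d (Qp p))"
  shows "g \<in> G_plus d k p \<longleftrightarrow>
    (\<forall>i\<in>{1..d}. padic_abs p (g i) \<le> 1) \<and> (\<forall>i\<in>{1..d - 1}. padic_abs p (g i) ^ k \<le> padic_abs p (g d))"
proof -
  have "g \<in> G_plus d k p \<longleftrightarrow> rho d k (Qp p) g \<in> matrices (2 * d - 1) (Zp p)"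
    using assms by (simp add: G_plus_def)
  also have "\<dots> \<longleftrightarrow> (\<forall>i\<in>{1..2 * d - 1}. rho d k (Qp p) g i i \<in> carrier (Zp p))"
    by (subst rho_eq_diag) (auto simp: matrices_def Zp_carrier padic_abs_zero)
  also have "\<dots> \<longleftrightarrow> (\<forall>i\<in>{1..2 * d - 1}. padic_abs p (rho d k (Qp p) g i i) \<le> 1)"
    using rho_diag_unit[OF assms] Q.Units_closed by (auto simp: Zp_carrier)
  also have "\<dots> \<longleftrightarrow> (\<forall>i\<in>{1..d}. padic_abs p (g i) \<le> 1) \<and>
      (\<forall>i\<in>{1..d - 1}. padic_abs p (g i) ^ k / padic_abs p (g d) \<le> 1)"
    unfolding index_split[OF assms(1)] ball_Un ball_simps
    using assms by (simp add: padic_abs_rho_low padic_abs_rho_high)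
  also have "\<dots> \<longleftrightarrow> (\<forall>i\<in>{1..d}. padic_abs p (g i) \<le> 1) \<and>
      (\<forall>i\<in>{1..d - 1}. padic_abs p (g i) ^ k \<le> padic_abs p (g d))"
  proof -
    have "g d \<in> Units (Qp p)" using assms by (auto simp: carrier_torus PiE_iff)
    then show ?thesis using padic_abs_unit_pos[of "g d"] by (simp add: divide_le_eq)
  qed
  finally show ?thesis .
qed

lemma padic_abs_det_rho:
  assumes "d \<ge> 1" "g \<in> carrier (torus d (Qp p))"
  shows "padic_abs p (mat_det (2 * d - 1) (Qp p) (rho d k (Qp p) g)) =
    (\<Prod>i\<in>{1..d}. padic_abs p (g i)) * (\<Prod>i\<in>{1..d - 1}. padic_abs p (g i) ^ k / padic_abs p (g d))"
proof -
  have c: "(\<lambda>i. rho d k (Qp p) g i i) \<in> {1..2 * d - 1} \<rightarrow> carrier (Qp p)"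
    using rho_diag_unit[OF assms] Q.Units_closed by auto
  have "padic_abs p (mat_det (2 * d - 1) (Qp p) (rho d k (Qp p) g)) =
      (\<Prod>i\<in>{1..2 * d - 1}. padic_abs p (rho d k (Qp p) g i i))"
    by (subst rho_eq_diag, subst Q.mat_det_diag[OF c], rule padic_abs_finprod[OF c])
  also have "\<dots> = (\<Prod>i\<in>{1..d}. padic_abs p (rho d k (Qp p) g i i)) *
      (\<Prod>i\<in>(+) d ` {1..d - 1}. padic_abs p (rho d k (Qp p) g i i))"
    unfolding index_split[OF assms(1)] by (rule prod.union_disjoint) auto
  also have "(\<Prod>i\<in>(+) d ` {1..d - 1}. padic_abs p (rho d k (Qp p) g i i)) =
      (\<Prod>i\<in>{1..d - 1}. padic_abs p (rho d k (Qp p) g (d + i) (d + i)))"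
    by (subst prod.reindex) auto
  also have "\<dots> = (\<Prod>i\<in>{1..d - 1}. padic_abs p (g i) ^ k / padic_abs p (g d))"
    by (intro prod.cong refl padic_abs_rho_high assms)
  also have "(\<Prod>i\<in>{1..d}. padic_abs p (rho d k (Qp p) g i i)) = (\<Prod>i\<in>{1..d}. padic_abs p (g i))"
    by (intro prod.cong refl padic_abs_rho_low)
  finally show ?thesis .
qed

text \<open>The cosets, for nonnegative valuation vectors \<open>n\<close>, of the maximal compact
  subgroup of the torus, which is the cell with \<open>n\<close> constantly 0.\<close>

definition cell :: "nat \<Rightarrow> (nat \<Rightarrow> nat) \<Rightarrow> (nat \<Rightarrow> padic) set" where
  "cell d n = {g \<in> carrier (torus d (Qp p)). \<forall>i\<in>{1..d}. padic_abs p (g i) = (1 / real p) ^ n i}"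

lemma cell_eq_coset:
  "\<exists>g\<in>carrier (torus d (Qp p)). cell d n = g <#\<^bsub>torus d (Qp p)\<^esub> cell d (\<lambda>_. 0)"
proof -
  have "\<forall>i. \<exists>X. X \<in> Units (Qp p) \<and> padic_abs p X = (1 / real p) ^ n i"
    using padic_unit_of_abs by blast
  then obtain G where G: "\<And>i. G i \<in> Units (Qp p)" "\<And>i. padic_abs p (G i) = (1 / real p) ^ n i"
    by metis
  define g where "g = restrict G {1..d}"
  have g: "g \<in> carrier (torus d (Qp p))" using G by (simp add: g_def carrier_torus)
  have "cell d n = g <#\<^bsub>torus d (Qp p)\<^esub> cell d (\<lambda>_. 0)"
  proof (intro equalityI subsetI)
    fix x assume x: "x \<in> cell d n"
    then have xU: "x \<in> PiE {1..d} (\<lambda>_. Units (Qp p))" by (simp add: cell_def carrier_torus)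
    define h where "h = (\<lambda>i\<in>{1..d}. inv\<^bsub>Qp p\<^esub> G i \<otimes>\<^bsub>Qp p\<^esub> x i)"
    have "padic_abs p (h i) = 1" if "i \<in> {1..d}" for i
    proof -
      have "padic_abs p (h i) = inverse ((1 / real p) ^ n i) * (1 / real p) ^ n i"
        using that x xU G unfolding h_def
        by (simp add: padic_abs_mult Q.Units_closed padic_abs_inv PiE_iff cell_def)
      also have "\<dots> = 1" using p_gt_1 by (intro left_inverse) auto
      finally show ?thesis .
    qed
    moreover have "h \<in> carrier (torus d (Qp p))"
      using G xU by (auto simp: h_def carrier_torus PiE_iff)
    ultimately have "h \<in> cell d (\<lambda>_. 0)" by (simp add: cell_def)
    moreover have "x = g \<otimes>\<^bsub>torus d (Qp p)\<^esub> h"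
    proof
      fix i
      show "x i = (g \<otimes>\<^bsub>torus d (Qp p)\<^esub> h) i"
      proof (cases "i \<in> {1..d}")
        case True
        then have xi: "x i \<in> carrier (Qp p)" using xU by (auto simp: PiE_iff Q.Units_closed)
        have "G i \<otimes>\<^bsub>Qp p\<^esub> (inv\<^bsub>Qp p\<^esub> G i \<otimes>\<^bsub>Qp p\<^esub> x i) = x i"
          using G xi by (simp add: Q.m_assoc[symmetric] Q.Units_closed)
        then show ?thesis using True by (simp add: mult_torus g_def h_def)
      next
        case False
        then show ?thesis using xU by (auto simp: mult_torus PiE_iff extensional_def)
      qed
    qed
    ultimately show "x \<in> g <#\<^bsub>torus d (Qp p)\<^esub> cell d (\<lambda>_. 0)" by (auto simp: l_coset_def)
  next
    fix x assume "x \<in> g <#\<^bsub>torus d (Qp p)\<^esub> cell d (\<lambda>_. 0)"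
    then obtain h where h: "h \<in> cell d (\<lambda>_. 0)" "x = g \<otimes>\<^bsub>torus d (Qp p)\<^esub> h"
      by (auto simp: l_coset_def)
    then show "x \<in> cell d n"
      using G by (auto simp: cell_def carrier_torus mult_torus g_def padic_abs_mult Q.Units_closed PiE_iff)
  qed
  with g show ?thesis by blast
qed

text \<open>
  A set of nonzero measure is measurable, since \<^const>\<open>emeasure\<close> vanishes outside the
  \<open>\<sigma>\<close>-algebra; hence the normalization and the invariance of the measure already make all
  cells measurable, without recourse to the topology.
\<close>

lemma cell_measure:
  assumes "d \<ge> 1" "normalized_haar_measure d k p M"
  shows "cell d n \<in> sets M" "emeasure M (cell d n) = 1"
proof -
  have "cell d (\<lambda>_. 0) = {g \<in> carrier (torus d (Qp p)). rho d k (Qp p) g \<in> GL (2 * d - 1) (Zp p)}"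
    using rho_in_GL_Zp_iff[OF assms(1)] by (auto simp: cell_def)
  then have 1: "emeasure M (cell d (\<lambda>_. 0)) = 1"
    using assms by (simp add: normalized_haar_measure_def)
  then have 0: "cell d (\<lambda>_. 0) \<in> sets M" using emeasure_notin_sets by fastforce
  obtain g where "g \<in> carrier (torus d (Qp p))" "cell d n = g <#\<^bsub>torus d (Qp p)\<^esub> cell d (\<lambda>_. 0)"
    using cell_eq_coset by blast
  then show 2: "emeasure M (cell d n) = 1"
    using assms(2) 0 1 by (simp add: normalized_haar_measure_def haar_measure_def)
  then show "cell d n \<in> sets M" using emeasure_notin_sets by fastforce
qed

end

section \<open>The zeta integral as a sum over cells\<close>

text \<open>The ceiling of m / k for k > 0: the least valuation open to a coordinate i < d when the
  last coordinate has valuation m.\<close>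

definition ceil_div :: "nat \<Rightarrow> nat \<Rightarrow> nat" where
  "ceil_div k m = (m + k - 1) div k"

text \<open>
  This is \<open>(k + 1) (d - 1) u - (d - 2) m\<close> for \<open>u = ceil_div k m\<close>, rearranged so that
  the only subtraction is the nonnegative \<open>k u - m\<close>.
\<close>

definition weight :: "nat \<Rightarrow> nat \<Rightarrow> nat \<Rightarrow> nat" where
  "weight d k m = (k + d - 1) * ceil_div k m + (d - 2) * (k * ceil_div k m - m)"

text \<open>Galois connection between ceiling division and multiplication by \<open>k\<close>; it
  turns the condition v_d <= k v_i into a lower bound for v_i.\<close>

lemma ceil_div_le_iff:
  assumes "k > 0"
  shows "ceil_div k m \<le> n \<longleftrightarrow> m \<le> k * n"
proof -
  have "ceil_div k m < Suc n \<longleftrightarrow> m + k - 1 < Suc n * k"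
    unfolding ceil_div_def by (rule div_less_iff_less_mult[OF assms])
  also have "\<dots> \<longleftrightarrow> m \<le> k * n" using assms by (simp add: mult.commute[of k]) linarith
  finally show ?thesis by (simp only: less_Suc_eq_le)
qed

text \<open>
  The valuations of a point of \<open>G\<^sup>+\<close> satisfy \<open>k v\<^sub>i \<ge> v\<^sub>d\<close> for \<open>i < d\<close>. Writing
  \<open>v\<^sub>i = ceil_div k v\<^sub>d + t\<^sub>i\<close> turns this into a product index set, on which the valuation
  of the determinant splits as a sum over the coordinates.
\<close>

definition level :: "nat \<Rightarrow> nat \<Rightarrow> (nat \<Rightarrow> nat) \<Rightarrow> nat \<Rightarrow> nat" where
  "level d k t i = (if i = d then t d else ceil_div k (t d) + t i)"

text \<open>For i < d, raising \<open>t i\<close> by 1 raises the valuation of x_i by 1 and that of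
  x_i^k / x_d by k, which gives the slope \<open>k + 1\<close>. Whatever depends on
  \<open>t d\<close> alone is collected in \<open>weight\<close>.\<close>

definition coord_weight :: "nat \<Rightarrow> nat \<Rightarrow> nat \<Rightarrow> nat \<Rightarrow> nat" where
  "coord_weight d k i n = (if i = d then weight d k n else (k + 1) * n)"

lemma insert_last: "d \<ge> 1 \<Longrightarrow> {1..d} = insert d {1..d - 1}" for d :: nat
  by auto

context padic
begin

lemma inverse_p_power_le_iff: "(1 / real p) ^ m \<le> (1 / real p) ^ n \<longleftrightarrow> n \<le> m"
proof (rule power_decreasing_iff)
  show "0 < 1 / real p" "1 / real p < 1" using p_gt_1 by simp_all
qed

lemma inverse_p_power_eq_iff: "(1 / real p) ^ m = (1 / real p) ^ n \<longleftrightarrow> m = n"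
  proof
  assume "(1 / real p) ^ m = (1 / real p) ^ n"
  then have "n \<le> m" "m \<le> n"
    unfolding inverse_p_power_le_iff[symmetric] by (simp_all only: order_refl)
  then show "m = n" by (rule order_antisym[rotated])
qed (rule arg_cong)

lemma padic_abs_unit_le_1:
  assumes "X \<in> Units (Qp p)" "padic_abs p X \<le> 1"
  shows "\<exists>n. padic_abs p X = (1 / real p) ^ n"
proof -
  obtain e where e: "padic_abs p X = real p powi e" using padic_abs_unit_range[OF assms(1)] by blast
  have "e \<le> 0"
  proof (rule ccontr)
    assume "\<not> e \<le> 0"
    then have "real p powi e > real p powi 0" using p_gt_1 by (intro power_int_strict_increasing) auto
    then show False using assms e by simp
  qed
  then have "padic_abs p X = (1 / real p) ^ nat (- e)"
    using e by (simp add: power_int_def divide_inverse)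
  then show ?thesis by blast
qed

lemma cell_level_subset_G_plus:
  assumes "d \<ge> 1" "k > 0" "g \<in> cell d (level d k t)"
  shows "g \<in> G_plus d k p"
proof -
  have g: "g \<in> carrier (torus d (Qp p))" using assms by (simp add: cell_def)
  have ab: "padic_abs p (g i) = (1 / real p) ^ level d k t i" if "i \<in> {1..d}" for i
    using assms that by (simp add: cell_def)
  have "padic_abs p (g i) \<le> 1" if "i \<in> {1..d}" for i
    using ab[OF that] p_gt_1 by (simp add: power_le_one)
  moreover have "padic_abs p (g i) ^ k \<le> padic_abs p (g d)" if i: "i \<in> {1..d - 1}" for i
  proof -
    have "t d \<le> k * ceil_div k (t d)" using ceil_div_le_iff[OF assms(2), of "t d" "ceil_div k (t d)"] by simp
    then have "t d \<le> level d k t i * k" using i by (auto simp: level_def algebra_simps)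
    moreover have "i \<in> {1..d}" using i by auto
    ultimately show ?thesis using assms(1)
      by (simp add: ab level_def[of d k t d] inverse_p_power_le_iff flip: power_mult)
  qed
  ultimately show ?thesis using G_plus_iff[OF assms(1) g] by blast
qed

text \<open>The valuations of \<open>g\<close> determine \<open>t d\<close>, then each other
  \<open>t i\<close> by cancelling \<open>ceil_div k (t d)\<close>; extensionality settles the
  arguments outside \<open>{1..d}\<close>.\<close>

lemma G_plus_unique_cell:
  assumes "d \<ge> 1" "k > 0" "g \<in> G_plus d k p"
  shows "\<exists>!t. t \<in> PiE {1..d} (\<lambda>_. UNIV) \<and> g \<in> cell d (level d k t)"
proof -
  have g: "g \<in> carrier (torus d (Qp p))" using assms(3) by (simp add: G_plus_def)
  then have "g i \<in> Units (Qp p)" if "i \<in> {1..d}" for i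
    using that by (auto simp: carrier_torus PiE_iff)
  moreover have "padic_abs p (g i) \<le> 1" if "i \<in> {1..d}" for i
    using G_plus_iff[OF assms(1) g] assms(3) that by blast
  ultimately have "\<forall>i\<in>{1..d}. \<exists>n. padic_abs p (g i) = (1 / real p) ^ n"
    by (intro ballI padic_abs_unit_le_1)
  then obtain n where "\<forall>i\<in>{1..d}. padic_abs p (g i) = (1 / real p) ^ n i"
    by (rule bchoice[THEN exE])
  then have n: "padic_abs p (g i) = (1 / real p) ^ n i" if "i \<in> {1..d}" for i
    using that by (rule bspec)
  have cd: "ceil_div k (n d) \<le> n i" if i: "i \<in> {1..d - 1}" for i
  proof -
    have "padic_abs p (g i) ^ k \<le> padic_abs p (g d)"
      using G_plus_iff[OF assms(1) g] assms(3) i by blast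
    moreover have "i \<in> {1..d}" using i by auto
    ultimately have "n d \<le> n i * k"
      using assms(1) by (simp add: n inverse_p_power_le_iff flip: power_mult)
    then show ?thesis by (simp add: ceil_div_le_iff[OF assms(2)] mult.commute)
  qed
  \<comment> \<open>The truncated subtraction is exact by \<open>cd\<close>.\<close>
  define t where "t = (\<lambda>i\<in>{1..d}. if i = d then n d else n i - ceil_div k (n d))"
  have "level d k t i = n i" if "i \<in> {1..d}" for i
    using that cd[of i] assms(1) by (auto simp: level_def t_def)
  then have "g \<in> cell d (level d k t)" using g n by (simp add: cell_def)
  moreover have "t \<in> PiE {1..d} (\<lambda>_. UNIV)" by (simp add: t_def)
  moreover have "t = t'"
    if t': "t' \<in> PiE {1..d} (\<lambda>_. UNIV)" "g \<in> cell d (level d k t')" for t'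
  proof (rule PiE_ext[OF \<open>t \<in> PiE {1..d} (\<lambda>_. UNIV)\<close> t'(1)])
    have eq: "level d k t i = level d k t' i" if "i \<in> {1..d}" for i
    proof -
      have "padic_abs p (g i) = (1 / real p) ^ level d k t i"
        "padic_abs p (g i) = (1 / real p) ^ level d k t' i"
        using \<open>g \<in> cell d (level d k t)\<close> t'(2) that unfolding cell_def by blast+
      then show ?thesis by (simp only: inverse_p_power_eq_iff)
    qed
    have "t d = t' d" using eq[of d] assms(1) by (simp add: level_def)

    then show "t i = t' i" if "i \<in> {1..d}" for i
      using eq[OF that] by (auto simp: level_def split: if_splits)
  qed
  ultimately show ?thesis by (intro ex1I[of _ t]) blast+
qed

lemma padic_abs_det_cell:
  assumes "d \<ge> 2" "k > 0" "g \<in> cell d (level d k t)"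
  shows "padic_abs p (mat_det (2 * d - 1) (Qp p) (rho d k (Qp p) g)) =
    (1 / real p) ^ (\<Sum>i\<in>{1..d}. coord_weight d k i (t i))"
proof -
  let ?b = "1 / real p" and ?u = "ceil_div k (t d)"
  have b: "?b \<noteq> 0" using p_gt_1 by auto
  have d: "d \<ge> 1" using assms by simp
  have g: "g \<in> carrier (torus d (Qp p))" using assms by (simp add: cell_def)
  have ab: "padic_abs p (g i) = ?b ^ level d k t i" if "i \<in> {1..d}" for i
    using assms that by (simp add: cell_def)
  have ku: "t d \<le> k * ?u" using ceil_div_le_iff[OF assms(2), of "t d" ?u] by simp
  \<comment> \<open>The rounding slack: the valuation of x_i^k / x_d at \<open>t i = 0\<close>.
    Naming it keeps natural subtraction out of the exponent computation.\<close>
  define \<delta> where "\<delta> = k * ?u - t d"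
  have \<delta>: "t d + \<delta> = k * ?u" using ku by (simp add: \<delta>_def)
  have low: "padic_abs p (g i) = ?b ^ (?u + t i)" if "i \<in> {1..d - 1}" for i
    using that ab[of i] by (auto simp: level_def)
  have last: "padic_abs p (g d) = ?b ^ t d" using ab[of d] d by (simp add: level_def)
  have high: "padic_abs p (g i) ^ k / padic_abs p (g d) = ?b ^ (k * t i + \<delta>)" if "i \<in> {1..d - 1}" for i
  proof -
    have "?b ^ (k * t i + \<delta>) * ?b ^ t d = ?b ^ (k * t i + k * ?u)"
      unfolding \<delta>[symmetric] by (simp add: power_add)
    also have "\<dots> = padic_abs p (g i) ^ k"
      unfolding low[OF that] power_mult[symmetric] by (simp add: algebra_simps)
    finally show ?thesis
      unfolding last nonzero_divide_eq_eq[OF power_not_zero[OF b]] by (rule sym)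
  qed
  obtain e where e: "d = Suc (Suc e)" using assms(1) that[of "d - 2"] by simp
  \<comment> \<open>The part of the exponent that depends on \<open>t d\<close> alone: v_d from x_d,
    and \<open>?u + \<delta>\<close> from each of the d - 1 pairs x_i, x_i^k / x_d. One
    \<open>\<delta>\<close> combines with v_d to k \<open>?u\<close>, which leaves d - 2 of
    them.\<close>
  have wt: "t d + (d - 1) * (?u + \<delta>) = weight d k (t d)"
  proof -
    have "t d + (d - 1) * (?u + \<delta>) = (t d + \<delta>) + (e + 1) * ?u + e * \<delta>"
      by (simp add: e algebra_simps)
    also have "\<dots> = (k + d - 1) * ?u + (d - 2) * \<delta>"
      unfolding \<delta> by (simp add: e algebra_simps)
    finally show ?thesis by (simp only: weight_def \<delta>_def)
  qed
  have "padic_abs p (mat_det (2 * d - 1) (Qp p) (rho d k (Qp p) g)) =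
    (\<Prod>i\<in>{1..d}. padic_abs p (g i)) * (\<Prod>i\<in>{1..d - 1}. padic_abs p (g i) ^ k / padic_abs p (g d))"
    by (rule padic_abs_det_rho[OF d g])
  also have "(\<Prod>i\<in>{1..d}. padic_abs p (g i)) = ?b ^ t d * (\<Prod>i\<in>{1..d - 1}. ?b ^ (?u + t i))"
    unfolding insert_last[OF d] using d
    by (subst prod.insert) (simp_all add: last low del: power_one_over power_divide)
  also have "(\<Prod>i\<in>{1..d - 1}. padic_abs p (g i) ^ k / padic_abs p (g d)) =
      (\<Prod>i\<in>{1..d - 1}. ?b ^ (k * t i + \<delta>))"
    by (rule prod.cong[OF refl high])
  also have "?b ^ t d * (\<Prod>i\<in>{1..d - 1}. ?b ^ (?u + t i)) * (\<Prod>i\<in>{1..d - 1}. ?b ^ (k * t i + \<delta>)) =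
      ?b ^ (t d + (\<Sum>i\<in>{1..d - 1}. ?u + t i) + (\<Sum>i\<in>{1..d - 1}. k * t i + \<delta>))"
    by (simp only: power_add power_sum)
  also have "t d + (\<Sum>i\<in>{1..d - 1}. ?u + t i) + (\<Sum>i\<in>{1..d - 1}. k * t i + \<delta>) =
      (t d + (d - 1) * (?u + \<delta>)) + (\<Sum>i\<in>{1..d - 1}. (k + 1) * t i)"
    by (simp only: sum.distrib sum_constant card_atLeastAtMost distrib_left distrib_right) (simp add: algebra_simps)
  also have "\<dots> = (\<Sum>i\<in>{1..d}. coord_weight d k i (t i))"
    unfolding wt insert_last[OF d] using d
    by (subst sum.insert) (auto simp: coord_weight_def intro!: sum.cong)
  finally show ?thesis .
qed

lemma zeta_integrand_cell:
  assumes "d \<ge> 2" "k > 0" "g \<in> cell d (level d k t)"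
  shows "zeta_integrand d k p s g =
    (\<Prod>i\<in>{1..d}. (of_nat p powr (- s)) ^ coord_weight d k i (t i))"
proof -
  have p: "real p > 0" using p_gt_1 by simp
  \<comment> \<open>The base is a positive real, so \<open>Ln\<close> is the real logarithm and the
    exponent \<open>E\<close> can be pulled out without a branch correction.\<close>
  have "complex_of_real ((1 / real p) ^ E) powr s = (of_nat p powr (- s)) ^ E" for E
  proof -
    have "ln ((1 / real p) ^ E) = - (real E * ln (real p))"
      using p by (simp add: ln_realpow ln_div)
    then have "complex_of_real ((1 / real p) ^ E) powr s = exp (s * of_real (- (real E * ln (real p))))"
      using p by (simp add: powr_def Ln_of_real del: of_real_power of_real_divide)
    also have "\<dots> = exp (of_nat E * (- s * Ln (of_nat p)))"
      using p by (simp add: Ln_of_nat algebra_simps)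
    also have "\<dots> = (of_nat p powr (- s)) ^ E"
      using p by (subst exp_of_nat_mult) (simp add: powr_def)
    finally show ?thesis .
  qed
  then show ?thesis
    unfolding zeta_integrand_def padic_abs_det_cell[OF assms] by (simp flip: power_sum)
qed

text \<open>The map \<open>idx\<close> from points to index vectors has the cells as fibres, each of
  measure 1, so it pushes the measure on \<open>G_plus\<close> forward to counting measure on the
  countable set \<open>T\<close>. Absolute summability and \<open>infsetsum\<close> are
  integrability and integral for counting measure, so convergence and value transfer
  together.\<close>

lemma zeta_as_sum:
  assumes "d \<ge> 2" "k > 0" "normalized_haar_measure d k p M"
  defines "T \<equiv> PiE {1..d} (\<lambda>_. UNIV :: nat set)"
    and "f \<equiv> \<lambda>s t. \<Prod>i\<in>{1..d}. (of_nat p powr (- s) :: complex) ^ coord_weight d k i (t i)"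
  shows "zeta_converges d k p M s \<longleftrightarrow> Infinite_Set_Sum.abs_summable_on (f s) T"
    and "local_zeta d k p M s = infsetsum (f s) T"
proof -
  have d: "d \<ge> 1" using assms by simp
  have cT: "countable T" unfolding T_def by (intro countable_PiE) auto
  define idx where "idx g = (THE t. t \<in> T \<and> g \<in> cell d (level d k t))" for g
  have idx: "idx g \<in> T" "g \<in> cell d (level d k (idx g))" if "g \<in> G_plus d k p" for g
    using theI'[OF G_plus_unique_cell[OF d assms(2) that]] unfolding idx_def T_def by blast+
  have idx_eq: "idx g = t" if "g \<in> cell d (level d k t)" "t \<in> T" for g t
    using G_plus_unique_cell[OF d assms(2) cell_level_subset_G_plus[OF d assms(2) that(1)]]
      idx[OF cell_level_subset_G_plus[OF d assms(2) that(1)]] that unfolding T_def by blast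
  have G: "G_plus d k p = (\<Union>t\<in>T. cell d (level d k t))"
    using idx cell_level_subset_G_plus[OF d assms(2)] by blast
  have Gs: "G_plus d k p \<in> sets M"
    unfolding G using cT cell_measure[OF d assms(3)] by (intro sets.countable_UN') auto
  have GM: "G_plus d k p \<subseteq> space M" by (rule sets.sets_into_space[OF Gs])
  define N where "N = restrict_space M (G_plus d k p)"
  have spN: "space N = G_plus d k p" using GM by (auto simp: N_def space_restrict_space)
  have pre: "idx -` {t} \<inter> G_plus d k p = cell d (level d k t)" if "t \<in> T" for t
    using idx idx_eq[OF _ that] cell_level_subset_G_plus[OF d assms(2)] by blast
  have cellN: "cell d (level d k t) \<in> sets N" for t
    using cell_measure(1)[OF d assms(3)] cell_level_subset_G_plus[OF d assms(2)] Gs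
    by (auto simp: N_def sets_restrict_space_iff)
  have meas: "idx \<in> measurable N (count_space T)"
    unfolding measurable_count_space_eq_countable[OF cT] spN using idx pre cellN by auto
  have distr: "distr N (count_space T) idx = count_space T"
  proof (rule measure_eqI_countable[OF _ _ cT])
    fix t assume t: "t \<in> T"
    have "emeasure (distr N (count_space T) idx) {t} = emeasure N (cell d (level d k t))"
      using t by (simp add: emeasure_distr[OF meas] spN pre)
    also have "\<dots> = emeasure M (cell d (level d k t))"
      unfolding N_def using cell_level_subset_G_plus[OF d assms(2)] Gs GM
      by (intro emeasure_restrict_space) auto
    also have "\<dots> = 1" by (rule cell_measure(2)[OF d assms(3)])
    finally show "emeasure (distr N (count_space T) idx) {t} = emeasure (count_space T) {t}"
      using t by simp
  qed auto
  have fN: "zeta_integrand d k p s g = f s (idx g)" if "g \<in> space N" for g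
    using zeta_integrand_cell[OF assms(1,2) idx(2)] that by (simp add: f_def spN)
  have GsM: "G_plus d k p \<inter> space M \<in> sets M" using Gs by simp
  have "zeta_converges d k p M s \<longleftrightarrow> integrable N (zeta_integrand d k p s)"
    by (simp add: zeta_converges_def set_integrable_def N_def integrable_restrict_space[OF GsM])
  also have "\<dots> \<longleftrightarrow> integrable N (\<lambda>g. f s (idx g))"
    by (rule Bochner_Integration.integrable_cong[OF refl fN])
  also have "\<dots> \<longleftrightarrow> integrable (distr N (count_space T) idx) (f s)"
    by (rule integrable_distr_eq[OF meas, symmetric]) simp
  finally show "zeta_converges d k p M s \<longleftrightarrow> Infinite_Set_Sum.abs_summable_on (f s) T"
    by (simp add: distr Infinite_Set_Sum.abs_summable_on_def)
  have "local_zeta d k p M s = integral\<^sup>L N (zeta_integrand d k p s)"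
    by (simp add: local_zeta_def set_lebesgue_integral_def N_def integral_restrict_space[OF GsM])
  also have "\<dots> = integral\<^sup>L N (\<lambda>g. f s (idx g))"
    by (rule Bochner_Integration.integral_cong[OF refl fN])
  also have "\<dots> = integral\<^sup>L (distr N (count_space T) idx) (f s)"
    by (rule integral_distr[OF meas, symmetric]) simp
  finally show "local_zeta d k p M s = infsetsum (f s) T"
    by (simp add: distr infsetsum_def)
qed

end

section \<open>Summation of the series\<close>

lemma ceil_div_add:
  assumes "k > 0"
  shows "ceil_div k (m + k) = Suc (ceil_div k m)"
proof -
  have "ceil_div k (m + k) = ((m + k - 1) + k) div k"
    unfolding ceil_div_def by (rule arg_cong[of _ _ "\<lambda>x. x div k"]) (use assms in simp)
  also have "\<dots> = (m + k - 1) div k + 1"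
    by (rule div_add_self2) (use assms in simp)
  finally show ?thesis by (simp add: ceil_div_def)
qed

lemma le_mult_ceil_div: "k > 0 \<Longrightarrow> m \<le> k * ceil_div k m"
  using ceil_div_le_iff[of k m "ceil_div k m"] by simp

lemma ceil_div_eq_1:
  assumes "1 \<le> m" "m \<le> k"
  shows "ceil_div k m = 1"
  using ceil_div_le_iff[of k m 1] ceil_div_le_iff[of k m 0] assms by simp

lemma weight_0: "k > 0 \<Longrightarrow> weight d k 0 = 0"
  by (simp add: weight_def ceil_div_def)

text \<open>Adding \<open>k\<close> to \<open>m\<close> raises the ceiling by 1 and leaves the
  rounding slack unchanged, so the weight is periodic up to a constant increment.\<close>

lemma weight_add:
  assumes "k > 0" "d \<ge> 1"
  shows "weight d k (m + k) = weight d k m + (k + d - 1)"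
proof -
  have "k * Suc (ceil_div k m) - (m + k) = k * ceil_div k m - m" by simp
  then show ?thesis by (simp add: weight_def ceil_div_add[OF assms(1)])
qed

text \<open>Dominates the series of powers \<open>y ^ weight d k m\<close> by the geometric
  series.\<close>

lemma weight_ge:
  assumes "k > 0" "d \<ge> 1"
  shows "m \<le> weight d k m"
proof -
  have "m \<le> k * ceil_div k m" by (rule le_mult_ceil_div[OF assms(1)])
  also have "\<dots> \<le> (k + d - 1) * ceil_div k m" using assms(2) by (intro mult_right_mono) auto
  finally show ?thesis by (simp add: weight_def)
qed

lemma weight_eq:
  assumes "1 \<le> m" "m \<le> k"
  shows "weight d k m = (k + d - 1) + (d - 2) * (k - m)"
  using ceil_div_eq_1[OF assms] by (simp add: weight_def)

text \<open>One period of the series in v_d. The coefficient ring is left open so that the same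
  expression serves over \<open>complex\<close> as a polynomial in Y, and over
  \<open>complex poly\<close> as a two-variable polynomial free of X.\<close>

definition zeta_num :: "nat \<Rightarrow> nat \<Rightarrow> 'a::comm_ring_1 poly" where
  "zeta_num d k = (\<Sum>m<k. monom 1 (weight d k m))"

definition zeta_den :: "nat \<Rightarrow> nat \<Rightarrow> 'a::comm_ring_1 poly" where
  "zeta_den d k = (1 - monom 1 (k + d - 1)) * (1 - monom 1 (k + 1)) ^ (d - 1)"

lemma poly_zeta_num: "poly (zeta_num d k) y = (\<Sum>m<k. y ^ weight d k m)"
  by (simp add: zeta_num_def poly_sum poly_monom)

lemma poly_zeta_den: "poly (zeta_den d k) y = (1 - y ^ (k + d - 1)) * (1 - y ^ (k + 1)) ^ (d - 1)"
  by (simp add: zeta_den_def poly_monom)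

lemma norm_power_less_1:
  fixes y :: complex
  assumes "norm y < 1" "n > 0"
  shows "norm (y ^ n) < 1"
  using power_Suc_less_one[of "norm y" "n - 1"] assms
  by (cases "y = 0") (auto simp: norm_power power_0_left)

lemma poly_zeta_den_nonzero:
  fixes y :: complex
  assumes "norm y < 1" "k > 0" "d \<ge> 1"
  shows "poly (zeta_den d k) y \<noteq> 0"
proof -
  have nz: "1 - y ^ n \<noteq> 0" if "n > 0" for n
    using norm_power_less_1[OF assms(1) that] by (metis eq_iff_diff_eq_0 less_irrefl norm_one)
  then show ?thesis
    unfolding poly_zeta_den using assms(2,3) by (intro no_zero_divisors power_not_zero nz) simp_all
qed

lemma summable_weight:
  fixes y :: complex
  assumes "norm y < 1" "k > 0" "d \<ge> 1"
  shows "Infinite_Set_Sum.abs_summable_on (\<lambda>m. y ^ weight d k m) UNIV"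
  unfolding abs_summable_on_nat_iff'
proof (rule summable_comparison_test')
  show "summable (\<lambda>m. norm y ^ m)" using assms(1) by (intro summable_geometric) simp
  show "norm (norm (y ^ weight d k m)) \<le> norm y ^ m" if "m \<ge> 0" for m
    using weight_ge[OF assms(2,3), of m] assms(1) by (simp add: norm_power power_decreasing)
qed

lemma infsetsum_weight:
  fixes y :: complex
  assumes "norm y < 1" "k > 0" "d \<ge> 1"
  shows "infsetsum (\<lambda>m. y ^ weight d k m) UNIV = poly (zeta_num d k) y / (1 - y ^ (k + d - 1))"
proof -
  let ?f = "\<lambda>m. y ^ weight d k m"
  have sm: "summable ?f"
    by (rule summable_norm_cancel[OF summable_weight[OF assms, unfolded abs_summable_on_nat_iff']])
  have "suminf ?f = (\<Sum>n. ?f (n + k)) + (\<Sum>i<k. ?f i)"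
    by (rule suminf_split_initial_segment[OF sm])
  \<comment> \<open>Shifting by a period multiplies every term by the same power of
    \<open>y\<close>, so the sum satisfies a linear equation.\<close>
  also have "(\<Sum>n. ?f (n + k)) = suminf ?f * y ^ (k + d - 1)"
    unfolding weight_add[OF assms(2,3)] power_add by (rule suminf_mult2[OF sm, symmetric])
  finally have "suminf ?f * (1 - y ^ (k + d - 1)) = poly (zeta_num d k) y"
    by (simp add: poly_zeta_num algebra_simps)
  moreover have "1 - y ^ (k + d - 1) \<noteq> 0"
  proof
    assume "1 - y ^ (k + d - 1) = 0"
    then have "norm (y ^ (k + d - 1)) = 1" by simp
    moreover have "norm (y ^ (k + d - 1)) < 1" using assms by (intro norm_power_less_1) auto
    ultimately show False by linarith
  qed
  ultimately show ?thesis
    using infsetsum_nat'[OF summable_weight[OF assms]] by (simp add: eq_divide_eq)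
qed

lemma summable_geometric_power:
  fixes y :: complex
  assumes "norm y < 1" "l > 0"
  shows "Infinite_Set_Sum.abs_summable_on (\<lambda>n. y ^ (l * n)) UNIV"
    and "infsetsum (\<lambda>n. y ^ (l * n)) UNIV = 1 / (1 - y ^ l)"
proof -
  have y: "norm (y ^ l) < 1" by (rule norm_power_less_1[OF assms])
  show sm: "Infinite_Set_Sum.abs_summable_on (\<lambda>n. y ^ (l * n)) UNIV"
    unfolding abs_summable_on_nat_iff' power_mult norm_power
    using y by (intro summable_geometric) (simp add: norm_power)
  show "infsetsum (\<lambda>n. y ^ (l * n)) UNIV = 1 / (1 - y ^ l)"
    unfolding infsetsum_nat'[OF sm] unfolding power_mult by (rule suminf_geometric[OF y])
qed

lemma infsetsum_coord_weight:
  fixes y :: complex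
  assumes "norm y < 1" "k > 0" "d \<ge> 1"
  defines "f \<equiv> \<lambda>t. \<Prod>i\<in>{1..d}. y ^ coord_weight d k i (t i)"
  shows "Infinite_Set_Sum.abs_summable_on f (PiE {1..d} (\<lambda>_. UNIV))"
    and "infsetsum f (PiE {1..d} (\<lambda>_. UNIV)) = poly (zeta_num d k) y / poly (zeta_den d k) y"
proof -
  have sm: "Infinite_Set_Sum.abs_summable_on (\<lambda>n. y ^ coord_weight d k i n) UNIV" for i
    using summable_weight[OF assms(1-3)] summable_geometric_power(1)[OF assms(1), of "k + 1"]
    by (cases "i = d") (simp_all add: coord_weight_def)
  show "Infinite_Set_Sum.abs_summable_on f (PiE {1..d} (\<lambda>_. UNIV))"
    unfolding f_def by (intro abs_summable_on_prod_PiE sm) auto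
  have "infsetsum f (PiE {1..d} (\<lambda>_. UNIV)) =
      (\<Prod>i\<in>{1..d}. infsetsum (\<lambda>n. y ^ coord_weight d k i n) UNIV)"
    unfolding f_def by (intro infsetsum_prod_PiE sm) auto
  also have "\<dots> = infsetsum (\<lambda>n. y ^ weight d k n) UNIV *
      (\<Prod>i\<in>{1..d - 1}. infsetsum (\<lambda>n. y ^ coord_weight d k i n) UNIV)"
    unfolding insert_last[OF assms(3)] using assms(3)
    by (subst prod.insert) (auto simp: coord_weight_def)
  also have "(\<Prod>i\<in>{1..d - 1}. infsetsum (\<lambda>n. y ^ coord_weight d k i n) UNIV) =
      (\<Prod>i\<in>{1..d - 1}. infsetsum (\<lambda>n. y ^ ((k + 1) * n)) UNIV)"
  proof (rule prod.cong[OF refl])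
    fix i assume "i \<in> {1..d - 1}"
    then have "i \<noteq> d" using assms(3) by auto
    then show "infsetsum (\<lambda>n. y ^ coord_weight d k i n) UNIV = infsetsum (\<lambda>n. y ^ ((k + 1) * n)) UNIV"
      by (simp add: coord_weight_def)
  qed
  also have "infsetsum (\<lambda>n. y ^ weight d k n) UNIV *
      (\<Prod>i\<in>{1..d - 1}. infsetsum (\<lambda>n. y ^ ((k + 1) * n)) UNIV) =
      poly (zeta_num d k) y / poly (zeta_den d k) y"
    unfolding infsetsum_weight[OF assms(1-3)] summable_geometric_power(2)[OF assms(1) zero_less_Suc[of k, unfolded Suc_eq_plus1]]
    by (simp add: poly_zeta_den power_divide)
  finally show "infsetsum f (PiE {1..d} (\<lambda>_. UNIV)) = poly (zeta_num d k) y / poly (zeta_den d k) y" .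
qed

lemma (in padic) local_zeta_eq:
  assumes "d \<ge> 2" "k > 0" "normalized_haar_measure d k p M" "Re s > 0"
  defines "y \<equiv> of_nat p powr (- s)"
  shows "norm y < 1" and "zeta_converges d k p M s"
    and "local_zeta d k p M s = poly (zeta_num d k) y / poly (zeta_den d k) y"
proof -
  have d: "d \<ge> 1" using assms(1) by simp
  have "norm y = real p powr (- Re s)"
    unfolding y_def by (subst norm_powr_real_powr) simp_all
  also have "\<dots> < real p powr 0" using p_gt_1 assms(4) by (intro powr_less_mono) simp_all
  also have "\<dots> = 1" using p_gt_1 by simp
  finally show y: "norm y < 1" .
  show "zeta_converges d k p M s"
    unfolding zeta_as_sum(1)[OF assms(1-3)]
    using infsetsum_coord_weight(1)[OF y assms(2) d] unfolding y_def .
  show "local_zeta d k p M s = poly (zeta_num d k) y / poly (zeta_den d k) y"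
    unfolding zeta_as_sum(2)[OF assms(1-3)]
    using infsetsum_coord_weight(2)[OF y assms(2) d] unfolding y_def .
qed

section \<open>Rational functions and functional equations\<close>

lemma eval2_simps [simp]:
  "eval2 (P * R) x y = eval2 P x y * eval2 R x y"
  "eval2 (P - R) x y = eval2 P x y - eval2 R x y"
  "eval2 (P ^ n) x y = eval2 P x y ^ n"
  "eval2 1 x y = 1" "eval2 0 x y = 0"
  "eval2 (monom 1 n) x y = y ^ n"
  by (simp_all add: eval2_def poly_monom)

lemma eval2_sum: "eval2 (\<Sum>i\<in>A. f i) x y = (\<Sum>i\<in>A. eval2 (f i) x y)"
  by (simp add: eval2_def poly_sum)

lemma eval2_zeta_num: "eval2 (zeta_num d k) x y = poly (zeta_num d k) y"
  by (simp add: poly_zeta_num) (simp add: zeta_num_def eval2_sum)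

lemma eval2_zeta_den: "eval2 (zeta_den d k) x y = poly (zeta_den d k) y"
  by (simp add: poly_zeta_den) (simp add: zeta_den_def)

lemma eval2_eq_poly_map_poly: "eval2 E x y = poly (map_poly (\<lambda>c. poly c x) E) y"
  by (induction E) (simp_all add: eval2_def map_poly_pCons)

lemma poly_eq_0_of_infinite_roots:
  fixes P :: "complex poly"
  assumes "infinite A" "\<And>z. z \<in> A \<Longrightarrow> poly P z = 0"
  shows "P = 0"
proof (rule ccontr)
  assume "P \<noteq> 0"
  then have "finite {z. poly P z = 0}" by (rule poly_roots_finite)
  moreover have "A \<subseteq> {z. poly P z = 0}" using assms(2) by blast
  ultimately show False using assms(1) finite_subset by blast
qed

text \<open>Root counting twice: for each \<open>x\<close> in \<open>A\<close> the specialization in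
  Y is the zero polynomial, so every coefficient, a polynomial in X, has all of \<open>A\<close>
  among its roots.\<close>

lemma eval2_eq_0_imp_eq_0:
  assumes "infinite A" "\<And>x. x \<in> A \<Longrightarrow> infinite {y. eval2 E x y = 0}"
  shows "E = 0"
proof (rule poly_eqI)
  fix i
  have "coeff E i = 0"
  proof (rule poly_eq_0_of_infinite_roots[OF assms(1)])
    fix x assume x: "x \<in> A"
    have "map_poly (\<lambda>c. poly c x) E = 0"
      by (rule poly_eq_0_of_infinite_roots[OF assms(2)[OF x]]) (simp add: eval2_eq_poly_map_poly)
    then have "coeff (map_poly (\<lambda>c. poly c x) E) i = 0" by simp
    then show "poly (coeff E i) x = 0" by (simp add: coeff_map_poly)
  qed
  then show "coeff E i = coeff 0 i" by simp
qed

text \<open>These are the sample values of p^s at s = n; the bound \<open>c\<close> keeps n inside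
  whichever right half-plane is given.\<close>

lemma infinite_powers_of_prime:
  assumes "prime (p::nat)"
  shows "infinite ((\<lambda>n. (of_nat p :: complex) ^ n) ` {n::nat. real n > c})"
proof -
  have p: "p > 1" by (rule prime_gt_1_nat[OF assms])
  have "inj_on (\<lambda>n. (of_nat p :: complex) ^ n) {n::nat. real n > c}"
  proof (rule inj_onI)
    fix m n :: nat assume "(of_nat p :: complex) ^ m = of_nat p ^ n"
    then have "(of_nat (p ^ m) :: complex) = of_nat (p ^ n)" by simp
    then have "p ^ m = p ^ n" by (simp only: of_nat_eq_iff)
    then show "m = n" using p by (simp add: power_inject_exp)
  qed
  moreover have "infinite {n::nat. real n > c}"
  proof -
    have "{nat \<lceil>c\<rceil> + 1..} \<subseteq> {n::nat. real n > c}" by (auto; linarith)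
    then show ?thesis using infinite_Ici infinite_super by blast
  qed
  ultimately show ?thesis by (simp add: finite_image_iff)
qed

section \<open>Existence and uniqueness of the interpolating rational function\<close>

lemma of_nat_powr_of_nat: "p > 0 \<Longrightarrow> (of_nat p :: complex) powr of_nat n = of_nat p ^ n"
  by (simp add: powr_nat')

lemma of_nat_powr_minus_of_nat: "p > 0 \<Longrightarrow> (of_nat p :: complex) powr (- of_nat n) = 1 / of_nat p ^ n"
  by (simp add: powr_minus of_nat_powr_of_nat divide_inverse)

text \<open>\<open>ratfun_eval\<close> uses the reduced fraction, while \<open>zeta_num\<close> and
  \<open>zeta_den\<close> need not be coprime. Coprimality shows that the reduced denominator
  \<open>b\<close> divides \<open>zeta_den\<close>, so it inherits nonvanishing for
  \<open>norm y < 1\<close>.\<close>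

lemma uniform_with_exists:
  assumes "d \<ge> 2" "k > 0" "\<And>p. prime p \<Longrightarrow> normalized_haar_measure d k p (\<mu> p)"
  shows "uniform_with d k \<mu> (Fract (zeta_num d k) (zeta_den d k))"
proof -
  define Q :: ratfun2 where "Q = Fract (zeta_num d k) (zeta_den d k)"
  define a b where "a = fst (quot_of_fract Q)" and "b = snd (quot_of_fract Q)"
  have d: "d \<ge> 1" using assms(1) by simp
  have den: "eval2 (zeta_den d k) x y \<noteq> 0" if "norm y < 1" for x y
    using poly_zeta_den_nonzero[OF that assms(2) d] by (simp add: eval2_zeta_den)
  then have D0: "(zeta_den d k :: complex poly poly) \<noteq> 0" using eval2_simps(5)
    by (metis norm_zero zero_less_one)
  have "Fract a b = Fract (zeta_num d k) (zeta_den d k)"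
    unfolding a_def b_def using Q_def by simp
  then have cross: "a * zeta_den d k = zeta_num d k * b"
    using D0 by (simp add: eq_fract b_def)
  have "coprime b a"
    unfolding a_def b_def by (rule coprime_quot_of_fract[THEN coprime_imp_coprime]) auto
  moreover have "b dvd a * zeta_den d k" unfolding cross by simp
  ultimately have "b dvd zeta_den d k" by (simp add: coprime_dvd_mult_right_iff)
  then obtain c where c: "zeta_den d k = b * c" by (rule dvdE)
  have eval: "ratfun_defined Q x y \<and> ratfun_eval Q x y = poly (zeta_num d k) y / poly (zeta_den d k) y"
    if "norm y < 1" for x y
  proof -
    have "eval2 b x y * eval2 c x y \<noteq> 0" using den[OF that, of x] by (simp add: c)
    then have b: "eval2 b x y \<noteq> 0" by simp
    have "eval2 (a * zeta_den d k) x y = eval2 (zeta_num d k * b) x y" by (simp only: cross)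
    then have "eval2 a x y * poly (zeta_den d k) y = poly (zeta_num d k) y * eval2 b x y"
      by (simp add: eval2_zeta_num eval2_zeta_den)
    then show ?thesis
      using b poly_zeta_den_nonzero[OF that assms(2) d]
      by (simp add: ratfun_defined_def ratfun_eval_def frac_eq_eq flip: a_def b_def)
  qed
  show ?thesis
    unfolding uniform_with_def Q_def[symmetric]
  proof (intro allI impI exI[of _ 0])
    fix p :: nat and s :: complex
    assume p: "prime p" and s: "Re s > 0"
    interpret padic p by unfold_locales (rule p)
    note z = local_zeta_eq[OF assms(1,2) assms(3)[OF p] s]
    show "zeta_converges d k p (\<mu> p) s \<and> ratfun_defined Q (of_nat p) (of_nat p powr - s) \<and>
        local_zeta d k p (\<mu> p) s = ratfun_eval Q (of_nat p) (of_nat p powr - s)"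
      using z eval[OF z(1)] by simp
  qed
qed

text \<open>The cross-multiplied difference \<open>E\<close> vanishes at x = p, y = p^(-n) for every
  prime p and all large n, hence identically. The conclusion thus holds at every (x, y), also where
  the zeta integral diverges.\<close>

lemma uniform_with_unique:
  assumes "d \<ge> 2" "k > 0" "\<And>p. prime p \<Longrightarrow> normalized_haar_measure d k p (\<mu> p)"
    and "uniform_with d k \<mu> Q"
  shows "eval2 (fst (quot_of_fract Q)) x y * poly (zeta_den d k) y =
    poly (zeta_num d k) y * eval2 (snd (quot_of_fract Q)) x y"
proof -
  define a b where "a = fst (quot_of_fract Q)" and "b = snd (quot_of_fract Q)"
  have d: "d \<ge> 1" using assms(1) by simp
  define E where "E = a * zeta_den d k - zeta_num d k * b"
  have "E = 0"
  proof (rule eval2_eq_0_imp_eq_0)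
    show "infinite (of_nat ` {p::nat. prime p} :: complex set)"
      using primes_infinite by (simp add: finite_image_iff inj_on_def)
    fix x :: complex assume "x \<in> of_nat ` {p::nat. prime p}"
    then obtain p where p: "prime p" and x: "x = of_nat p" by auto
    interpret padic p by unfold_locales (rule p)
    obtain \<sigma> where \<sigma>: "\<And>s. Re s > \<sigma> \<Longrightarrow> ratfun_defined Q (of_nat p) (of_nat p powr (- s)) \<and>
        local_zeta d k p (\<mu> p) s = ratfun_eval Q (of_nat p) (of_nat p powr (- s))"
      using assms(4) p unfolding uniform_with_def by blast
    let ?Y = "(\<lambda>n. (of_nat p :: complex) ^ n) ` {n::nat. real n > max \<sigma> 0}"
    have "eval2 E x (inverse z) = 0" if zY: "z \<in> ?Y" for z
    proof -
      obtain n where n: "real n > max \<sigma> 0" "z = of_nat p ^ n" using zY by auto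
      let ?s = "of_nat n :: complex" and ?y = "(of_nat p :: complex) powr (- of_nat n)"
      have y: "?y = inverse z"
        using n(2) p prime_gt_0_nat by (simp add: of_nat_powr_minus_of_nat divide_inverse)
      have s: "Re ?s > \<sigma>" "Re ?s > 0" using n by auto
      note z = local_zeta_eq[OF assms(1,2) assms(3)[OF p] s(2)]
      have b: "eval2 b x ?y \<noteq> 0"
        using \<sigma>[OF s(1)] by (simp add: ratfun_defined_def b_def x)
      have "eval2 a x ?y / eval2 b x ?y = poly (zeta_num d k) ?y / poly (zeta_den d k) ?y"
        using \<sigma>[OF s(1)] z(3) by (simp add: ratfun_eval_def a_def b_def x)
      then have "eval2 E x ?y = 0"
        using b poly_zeta_den_nonzero[OF z(1) assms(2) d]
        by (simp add: E_def eval2_zeta_num eval2_zeta_den frac_eq_eq)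
      then show ?thesis by (simp only: y)
    qed
    then have "inverse ` ?Y \<subseteq> {y. eval2 E x y = 0}" by blast
    moreover have "infinite (inverse ` ?Y)"
    proof
      assume "finite (inverse ` ?Y)"
      then have "finite ?Y" by (rule finite_imageD) (simp add: inj_on_def)
      then show False using infinite_powers_of_prime[OF p] by blast
    qed
    ultimately show "infinite {y. eval2 E x y = 0}" using infinite_super by blast
  qed
  then have "eval2 E x y = 0" by simp
  then show ?thesis by (simp add: E_def a_def b_def eval2_zeta_num eval2_zeta_den)
qed

section \<open>Self-reciprocity: the numerator fails it, the denominator has it\<close>

lemma poly_eq_smult_of_power_int:
  fixes P R :: "complex poly"
  assumes "poly P 0 \<noteq> 0" "poly R 0 \<noteq> 0" "infinite A"
    and A: "\<And>z. z \<in> A \<Longrightarrow> z \<noteq> 0 \<and> poly P z = c * z powi e * poly R z"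
  shows "P = smult c R"
proof (cases "e \<ge> 0")
  case True
  have "P - smult c (monom 1 (nat e) * R) = 0"
    by (rule poly_eq_0_of_infinite_roots[OF assms(3)])
      (use A True in \<open>simp add: poly_monom power_int_def\<close>)
  then have P: "P = smult c (monom 1 (nat e) * R)" by simp
  then have "poly P 0 = c * 0 ^ nat e * poly R 0" by (simp add: poly_monom)
  \<comment> \<open>A positive power of z would make \<open>P\<close> vanish at 0.\<close>
  then have "nat e = 0" using assms(1) by (cases "nat e") auto
  then show ?thesis using P by (simp add: monom_0)
next
  case False
  have "monom 1 (nat (- e)) * P - smult c R = 0"
  proof (rule poly_eq_0_of_infinite_roots[OF assms(3)])
    fix z assume "z \<in> A"
    then have z: "z \<noteq> 0" "poly P z = c * z powi e * poly R z" using A by auto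
    have "z ^ nat (- e) * z powi e = 1"
      using z(1) False by (simp add: power_int_def field_simps)
    then show "poly (monom 1 (nat (- e)) * P - smult c R) z = 0"
      unfolding poly_diff poly_mult poly_monom poly_smult z(2) by (simp add: algebra_simps)
  qed
  then have eq: "monom 1 (nat (- e)) * P = smult c R" by simp
  then have "poly (monom 1 (nat (- e)) * P) 0 = c * poly R 0" by simp
  \<comment> \<open>Here the left side vanishes at 0 and \<open>R\<close> does not, so only
    \<open>c = 0\<close> is left, and then \<open>P\<close> itself would be 0.\<close>
  then have "c = 0" using assms(2) False by (simp add: poly_monom power_0_left)
  then have "P = 0" using eq by simp
  then show ?thesis using assms(1) by simp
qed

text \<open>The constant term counts the indices of exponent 0, so nothing cancels in characteristic
  0.\<close>

lemma poly_sum_monom_0: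
  assumes "m \<in> A" "finite A" "e m = 0"
  shows "poly (\<Sum>m\<in>A. monom 1 (e m)) (0 :: complex) \<noteq> 0"
proof -
  have "poly (\<Sum>m\<in>A. monom 1 (e m)) (0 :: complex) = (\<Sum>m\<in>A. if e m = 0 then 1 else 0)"
    by (simp add: poly_sum poly_monom power_0_left)
  also have "\<dots> = of_nat (card {m \<in> A. e m = 0})"
    using assms(2) by (simp add: sum.If_cases Int_def)
  also have "\<dots> \<noteq> 0" using assms by (auto simp: card_eq_0_iff)
  finally show ?thesis .
qed

lemma pderiv_sum: "pderiv (\<Sum>i\<in>A. f i) = (\<Sum>i\<in>A. pderiv (f i))"
  by (induction A rule: infinite_finite_induct) (simp_all add: pderiv_add)

lemma poly_pderiv_monom_1: "poly (pderiv (monom 1 n)) (1 :: complex) = of_nat n"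
  by (simp add: pderiv_monom poly_monom)

text \<open>Identifies \<open>weight d k 1\<close> as the degree of the numerator, the exponent by
  which it is reversed.\<close>

lemma weight_le_weight_1:
  assumes "m < k" "d \<ge> 2"
  shows "weight d k m \<le> weight d k 1"
proof (cases "m = 0")
  case False
  then have "(d - 2) * (k - m) \<le> (d - 2) * (k - 1)" by (intro mult_le_mono2) auto
  then show ?thesis using False assms weight_eq[of m k d] weight_eq[of 1 k d] by linarith
qed (use assms weight_0[of k d] in simp)

text \<open>The two sides are the derivatives at 1 of the numerator and of its reversal. Both
  contain \<open>(d - 2) * S\<close>; what remains is k - 1 copies of \<open>k + d - 1\<close>
  against a single one, and k - 1 > 1.\<close>

lemma sum_weight_asymmetric:
  assumes "d \<ge> 2" "k \<ge> 3"
  shows "(\<Sum>m<k. weight d k m) \<noteq> (\<Sum>m<k. weight d k 1 - weight d k m)"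
proof
  define S where "S = (\<Sum>m\<in>{1..<k}. m)"
  have split: "{..<k} = insert 0 {1..<k}" using assms(2) by auto
  have rev: "(\<Sum>m\<in>{1..<k}. k - m) = S"
    unfolding S_def by (subst sum.atLeastLessThan_rev) (auto intro!: sum.cong)
  have "(\<Sum>m\<in>{1..<k}. (m - 1) + 1) = S"
    unfolding S_def by (intro sum.cong) auto
  then have pred: "(\<Sum>m\<in>{1..<k}. m - 1) + (k - 1) = S"
    by (simp only: sum.distrib) simp
  have w0: "weight d k 0 = 0" using assms(2) by (intro weight_0) simp
  have w: "weight d k m = (k + d - 1) + (d - 2) * (k - m)" if "m \<in> {1..<k}" for m
    using that by (intro weight_eq) auto
  have "(\<Sum>m<k. weight d k m) = (\<Sum>m\<in>{1..<k}. (k + d - 1) + (d - 2) * (k - m))"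
    unfolding split using w by (simp add: w0)
  also have "\<dots> = (k - 1) * (k + d - 1) + (d - 2) * S"
    by (simp only: sum.distrib sum_distrib_left[symmetric] rev) simp
  finally have 1: "(\<Sum>m<k. weight d k m) = (k - 1) * (k + d - 1) + (d - 2) * S" .
  have "weight d k 1 - weight d k m = (d - 2) * (m - 1)" if "m \<in> {1..<k}" for m
  proof -
    have "weight d k 1 = (k + d - 1) + (d - 2) * (k - 1)" using assms(2) by (intro weight_eq) auto
    moreover have "k - 1 = (k - m) + (m - 1)" using that by auto
    ultimately show ?thesis unfolding w[OF that] by (simp add: distrib_left)
  qed
  then have "(\<Sum>m<k. weight d k 1 - weight d k m) = weight d k 1 + (d - 2) * (\<Sum>m\<in>{1..<k}. m - 1)"
    unfolding split by (simp add: w0 sum_distrib_left)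
  \<comment> \<open>The index m = 0 contributes all of \<open>weight d k 1\<close>; its part
    \<open>(d - 2) * (k - 1)\<close> adds 1 to each of the k - 1 summands \<open>m - 1\<close> and
    so completes them to \<open>S\<close>.\<close>
  also have "\<dots> = (k + d - 1) + (d - 2) * ((\<Sum>m\<in>{1..<k}. m - 1) + (k - 1))"
  proof -
    have "weight d k 1 = (k + d - 1) + (d - 2) * (k - 1)" using assms(2) by (intro weight_eq) auto
    then show ?thesis by (simp only: distrib_left add_ac)
  qed
  finally have 2: "(\<Sum>m<k. weight d k 1 - weight d k m) = (k + d - 1) + (d - 2) * S"
    unfolding pred .
  assume "(\<Sum>m<k. weight d k m) = (\<Sum>m<k. weight d k 1 - weight d k m)"
  then have "(k - 1) * (k + d - 1) = 1 * (k + d - 1)" unfolding 1 2 by simp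
  then show False using assms by (simp only: mult_cancel2) auto
qed

text \<open>
  The numerator is not self-reciprocal: comparing the values at 1 shows that the factor would have
  to be 1, and then the derivatives at 1 would give \<open>(k - 2) (k + d - 1) = 0\<close>.
\<close>

lemma zeta_num_not_self_reciprocal:
  assumes "d \<ge> 2" "k \<ge> 3" "infinite A"
  shows "\<exists>z\<in>A. z = 0 \<or> poly (zeta_num d k) z \<noteq> (c :: complex) * z powi e * poly (zeta_num d k) (1 / z)"
proof (rule ccontr)
  assume neg: "\<not> ?thesis"
  define n where "n = weight d k 1"
  \<comment> \<open>The reversal z^n N(1/z) of the numerator N; the subtractions are exact because
    \<open>n\<close> is the largest exponent.\<close>
  define R :: "complex poly" where "R = (\<Sum>m<k. monom 1 (n - weight d k m))"
  have R: "poly R z = z ^ n * poly (zeta_num d k) (1 / z)" if "z \<noteq> 0" for z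
  proof -
    have "z ^ (n - weight d k m) = z ^ n * (1 / z) ^ weight d k m" if "m < k" for m
      using weight_le_weight_1[OF that assms(1)] \<open>z \<noteq> 0\<close>
      by (simp add: n_def power_diff power_divide)
    then show ?thesis
      by (simp add: R_def poly_sum poly_monom poly_zeta_num sum_distrib_left)
  qed
  have "zeta_num d k = smult c R"
  proof (rule poly_eq_smult_of_power_int[OF _ _ assms(3)])
    show "poly (zeta_num d k) 0 \<noteq> (0::complex)"
      unfolding zeta_num_def using assms(2) by (intro poly_sum_monom_0[of 0]) (auto simp: weight_0)
    \<comment> \<open>The index m = 1 attains the largest exponent and so yields a constant
      term.\<close>
    show "poly R 0 \<noteq> 0"
      unfolding R_def using assms(2) by (intro poly_sum_monom_0[of 1]) (auto simp: n_def)
    fix z assume "z \<in> A"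
    then have z: "z \<noteq> 0" "poly (zeta_num d k) z = c * z powi e * poly (zeta_num d k) (1 / z)"
      using neg by auto
    have "z powi e = z powi (e - int n) * z ^ n"
      using z(1) by (simp add: power_int_diff)
    then show "z \<noteq> 0 \<and> poly (zeta_num d k) z = c * z powi (e - int n) * poly R z"
      using z by (simp add: R)
  qed
  moreover have "poly (zeta_num d k) 1 = (of_nat k :: complex)" "poly R 1 = of_nat k"
    by (simp_all add: poly_zeta_num R_def poly_sum poly_monom)
  ultimately have "(of_nat k :: complex) = c * of_nat k" by (metis poly_smult)
  then have "c = 1" using assms(2) by simp
  with \<open>zeta_num d k = smult c R\<close> have "poly (pderiv (zeta_num d k)) 1 = poly (pderiv R) 1" by simp
  then have "(of_nat (\<Sum>m<k. weight d k m) :: complex) = of_nat (\<Sum>m<k. n - weight d k m)"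
    by (simp add: zeta_num_def R_def pderiv_sum poly_sum poly_pderiv_monom_1 del: of_nat_diff)
  then show False using sum_weight_asymmetric[OF assms(1,2)] unfolding n_def of_nat_eq_iff by simp
qed

text \<open>Each of the 1 + (d - 1) factors satisfies 1 - z^n = - z^n (1 - z^(-n)); signs and powers
  of z multiply up.\<close>

lemma poly_zeta_den_reciprocal:
  fixes z :: complex
  assumes "z \<noteq> 0"
  shows "poly (zeta_den d k) z =
    (- 1) ^ (1 + (d - 1)) * z ^ ((k + d - 1) + (k + 1) * (d - 1)) * poly (zeta_den d k) (1 / z)"
proof -
  have f: "1 - z ^ n = - 1 * z ^ n * (1 - (1 / z) ^ n)" for n
    using assms by (simp add: power_divide right_diff_distrib)
  have "poly (zeta_den d k) z = (- 1 * z ^ (k + d - 1) * (1 - (1 / z) ^ (k + d - 1))) *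
      (- 1 * z ^ (k + 1) * (1 - (1 / z) ^ (k + 1))) ^ (d - 1)"
    unfolding poly_zeta_den by (simp only: f[of "k + d - 1"] f[of "k + 1"])
  also have "\<dots> = (- 1) ^ (1 + (d - 1)) * z ^ ((k + d - 1) + (k + 1) * (d - 1)) *
      poly (zeta_den d k) (1 / z)"
    by (simp only: poly_zeta_den power_mult_distrib power_mult[symmetric] power_one_right
        power_add[of z "k + d - 1"] power_add[of "- 1" 1] mult_ac)
  finally show ?thesis .
qed

text \<open>The first conjunct gives the second its content:
  \<open>satisfies_functional_equation\<close> asks for some uniform \<open>Q\<close>, so without
  one its negation would hold trivially.\<close>

theorem proposition6p1:
  fixes d k :: nat and \<mu> :: "nat \<Rightarrow> (nat \<Rightarrow> padic) measure"
  assumes "d \<ge> 2" and "k \<ge> 3"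
    and "\<And>p. prime p \<Longrightarrow> normalized_haar_measure d k p (\<mu> p)"
  shows "(\<exists>Q. uniform_with d k \<mu> Q) \<and>
    (\<forall>p. prime p \<longrightarrow> \<not> satisfies_functional_equation d k \<mu> p)"
proof (intro conjI allI impI notI)
  have k: "k > 0" and d: "d \<ge> 1" using assms by simp_all
  show "\<exists>Q. uniform_with d k \<mu> Q" using uniform_with_exists[OF assms(1) k assms(3)] by blast
  fix p :: nat assume p: "prime p" and "satisfies_functional_equation d k \<mu> p"
  then obtain Q m a b \<sigma> where Q: "uniform_with d k \<mu> Q"
    and fe: "\<And>s. Re s > \<sigma> \<Longrightarrow> ratfun_defined Q (1 / of_nat p) (of_nat p powr s) \<and>
          ratfun_eval Q (1 / of_nat p) (of_nat p powr s) =
            (- 1) powi m * of_nat p powr (of_int a + of_int b * s) * local_zeta d k p (\<mu> p) s"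
    unfolding satisfies_functional_equation_def by blast
  interpret padic p by unfold_locales (rule p)
  have p0: "p > 0" using p prime_gt_0_nat by blast
  define l where "l = (k + d - 1) + (k + 1) * (d - 1)"
  define c0 :: complex where "c0 = (- 1) powi m * of_nat p powr of_int a"
  define A where "A = (\<lambda>n. (of_nat p :: complex) ^ n) ` {n::nat. real n > max \<sigma> 0}"
  have "z \<noteq> 0 \<and> poly (zeta_num d k) z =
      (c0 * (- 1) ^ (1 + (d - 1))) * z powi (b + int l) * poly (zeta_num d k) (1 / z)" if zA: "z \<in> A" for z
  proof -
    obtain n where n: "real n > max \<sigma> 0" "z = of_nat p ^ n" using zA by (auto simp: A_def)
    let ?s = "of_nat n :: complex"
    let ?N = "poly (zeta_num d k) :: complex \<Rightarrow> complex" and ?D = "poly (zeta_den d k) :: complex \<Rightarrow> complex"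
    have z0: "z \<noteq> 0" using n(2) p0 by simp
    have s: "Re ?s > \<sigma>" "Re ?s > 0" using n by auto
    have pz: "of_nat p powr ?s = z" "of_nat p powr (- ?s) = 1 / z"
      using n(2) p0 by (simp_all add: of_nat_powr_of_nat of_nat_powr_minus_of_nat)
    have "of_nat p powr (of_int a + of_int b * ?s) = of_nat p powr of_int a * (of_nat p powr ?s) powi b"
      unfolding powr_add using p0 by (simp add: powr_def exp_power_int mult_ac)
    then have pab: "of_nat p powr (of_int a + of_int b * ?s) = of_nat p powr of_int a * z powi b"
      by (simp only: pz)
    note zeta = local_zeta_eq[OF assms(1) k assms(3)[OF p] s(2), unfolded pz]
    have D1: "?D (1 / z) \<noteq> 0" by (rule poly_zeta_den_nonzero[OF zeta(1) k d])
    have DD: "?D z = (- 1) ^ (1 + (d - 1)) * z ^ l * ?D (1 / z)"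
      unfolding l_def by (rule poly_zeta_den_reciprocal[OF z0])
    then have D2: "?D z \<noteq> 0" using D1 z0 by simp
    have def: "eval2 (snd (quot_of_fract Q)) (1 / of_nat p) z \<noteq> 0"
      using fe[OF s(1)] by (simp add: ratfun_defined_def pz)
    \<comment> \<open>Here z = p^n lies outside the disc of convergence, so this rests on the
      polynomial identity for \<open>Q\<close> and not on the integral.\<close>
    have "?N z / ?D z = ratfun_eval Q (1 / of_nat p) z"
      using uniform_with_unique[OF assms(1) k assms(3) Q, of "1 / of_nat p" z] def D2
      by (simp add: ratfun_eval_def frac_eq_eq)
    also have "\<dots> = c0 * z powi b * (?N (1 / z) / ?D (1 / z))"
      using fe[OF s(1)] by (simp add: pz pab zeta(3) c0_def)
    finally have "?N z = c0 * z powi b * (?N (1 / z) / ?D (1 / z)) * ?D z"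
      using D2 by (simp add: divide_eq_eq)
    \<comment> \<open>The quotient of \<open>?D z\<close> by \<open>?D (1 / z)\<close> is a sign
      times \<open>z ^ l\<close>; both are absorbed into the constant and the exponent, and a
      relation for the numerator alone remains.\<close>
    also have "\<dots> = (c0 * (- 1) ^ (1 + (d - 1))) * (z powi b * z ^ l) * ?N (1 / z)"
      unfolding DD using D1 by (simp add: field_simps)
    also have "z powi b * z ^ l = z powi (b + int l)"
      using z0 by (simp add: power_int_add)
    finally show ?thesis using z0 by simp
  qed
  moreover have "infinite A" unfolding A_def by (rule infinite_powers_of_prime[OF p])
  ultimately show False
    using zeta_num_not_self_reciprocal[OF assms(1,2), of A "c0 * (- 1) ^ (1 + (d - 1))" "b + int l"]
    by blast
qed

end
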